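(* Let $S\subset\mathbb{R}^3$ be a regular ($C^\infty$) surface. Then $S$ is a translation surface with constant Gaussian curvature if and only if $S$ is locally cylindrical, i.e. every point of $S$ has an open neighbourhood in $S$ that is a cylindrical surface. In other words, cylindrical surfaces are the only translation surfaces in $\mathbb{R}^3$ with constant Gaussian curvature.
   Context: All curves and surfaces are of class $C^\infty$. A regular surface $S\subset\mathbb{R}^3$ is called a translation surface if it can be locally written as the sum $\Psi(s,t)=\alpha(s)+\beta(t)$ of two space curves $\alpha:I\subset\mathbb{R}\to\mathbb{R}^3$ and $\beta:J\subset\mathbb{R}\to\mathbb{R}^3$; that is, every point of $S$ has an open neighbourhood in $S$ admitting a regular parametrization of the form $\Psi(s,t)=\alpha(s)+\beta(t)$, $(s,t)\in I\times J$, with $I,J$ open intervals, $\alpha,\beta$ smooth curves and $\alpha'(s)\times\beta'(t)\neq 0$ for all $(s,t)$. The curves $\alpha,\beta$ are called the generating curves. A cylindrical surface is a ruled surface in $\mathbb{R}^3$ whose rulings (straight line segments) are all parallel to one constant direction (pieces of planes are included). *)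

theory Defs
  imports "HOL-Analysis.Analysis"
begin

subsection \<open>Smooth maps\<close>

text \<open>Only meaningful for open \<open>U\<close>, since the derivatives are two-sided. For a differentiable
  \<open>f\<close>, the map \<open>x \<mapsto> frechet_derivative f (at x) v\<close> is the directional derivative along \<open>v\<close>;
  \<open>C\<^sup>k\<close> is the usual recursion on the order of continuous differentiability.\<close>

primrec Ck_on :: "nat \<Rightarrow> ('a::euclidean_space \<Rightarrow> 'b::euclidean_space) \<Rightarrow> 'a set \<Rightarrow> bool" where
  "Ck_on 0 f U \<longleftrightarrow> continuous_on U f"
| "Ck_on (Suc k) f U \<longleftrightarrow>
     f differentiable_on U \<and> (\<forall>v. Ck_on k (\<lambda>x. frechet_derivative f (at x) v) U)"

definition smooth_map_on :: "('a::euclidean_space \<Rightarrow> 'b::euclidean_space) \<Rightarrow> 'a set \<Rightarrow> bool" where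
  "smooth_map_on f U \<longleftrightarrow> (\<forall>k. Ck_on k f U)"

subsection \<open>Regular surfaces\<close>

definition du :: "(real \<times> real \<Rightarrow> real^3) \<Rightarrow> real \<times> real \<Rightarrow> real^3" where
  "du X p = frechet_derivative X (at p) (1, 0)"

definition dv :: "(real \<times> real \<Rightarrow> real^3) \<Rightarrow> real \<times> real \<Rightarrow> real^3" where
  "dv X p = frechet_derivative X (at p) (0, 1)"

definition regular_parametrization ::
    "(real^3) set \<Rightarrow> (real \<times> real) set \<Rightarrow> (real \<times> real \<Rightarrow> real^3) \<Rightarrow> bool" where
  "regular_parametrization S U X \<longleftrightarrow>
     open U \<and> smooth_map_on X U \<and>
     openin (top_of_set S) (X ` U) \<and>
     (\<exists>Y. homeomorphism U (X ` U) X Y) \<and>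
     (\<forall>p\<in>U. cross3 (du X p) (dv X p) \<noteq> 0)"

definition regular_surface :: "(real^3) set \<Rightarrow> bool" where
  "regular_surface S \<longleftrightarrow> (\<forall>q\<in>S. \<exists>U X. regular_parametrization S U X \<and> q \<in> X ` U)"

subsection \<open>Gaussian curvature\<close>

definition unit_normal :: "(real \<times> real \<Rightarrow> real^3) \<Rightarrow> real \<times> real \<Rightarrow> real^3" where
  "unit_normal X p = (cross3 (du X p) (dv X p)) /\<^sub>R norm (cross3 (du X p) (dv X p))"

text \<open>Determinant of the second fundamental form divided by that of the first.\<close>

definition param_gaussian_curvature :: "(real \<times> real \<Rightarrow> real^3) \<Rightarrow> real \<times> real \<Rightarrow> real" where
  "param_gaussian_curvature X p =
     (let E = du X p \<bullet> du X p; F = du X p \<bullet> dv X p; G = dv X p \<bullet> dv X p;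
          L = du (du X) p \<bullet> unit_normal X p;
          M = dv (du X) p \<bullet> unit_normal X p;
          N = dv (dv X) p \<bullet> unit_normal X p
      in (L * N - M\<^sup>2) / (E * G - F\<^sup>2))"

text \<open>The value does not depend on the parametrization chosen around \<open>q\<close>. The first conjunct
  makes \<open>k\<close> unique; it holds at every point of a regular surface.\<close>

definition has_gaussian_curvature :: "(real^3) set \<Rightarrow> real^3 \<Rightarrow> real \<Rightarrow> bool" where
  "has_gaussian_curvature S q k \<longleftrightarrow>
     (\<exists>U X. regular_parametrization S U X \<and> q \<in> X ` U) \<and>
     (\<forall>U X. \<forall>p\<in>U. regular_parametrization S U X \<and> X p = q \<longrightarrow> param_gaussian_curvature X p = k)"

lemma has_gaussian_curvature_unique:
  "has_gaussian_curvature S q k \<Longrightarrow> has_gaussian_curvature S q k' \<Longrightarrow> k = k'"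
  unfolding has_gaussian_curvature_def by blast

definition constant_gaussian_curvature :: "(real^3) set \<Rightarrow> bool" where
  "constant_gaussian_curvature S \<longleftrightarrow> (\<exists>k. \<forall>q\<in>S. has_gaussian_curvature S q k)"

subsection \<open>Translation surfaces and cylindrical surfaces\<close>

definition translation_surface :: "(real^3) set \<Rightarrow> bool" where
  "translation_surface S \<longleftrightarrow>
     regular_surface S \<and>
     (\<forall>q\<in>S. \<exists>I J \<alpha> \<beta>.
        open I \<and> is_interval I \<and> open J \<and> is_interval J \<and>
        smooth_map_on \<alpha> I \<and> smooth_map_on \<beta> J \<and>
        (\<forall>s\<in>I. \<forall>t\<in>J. cross3 (vector_derivative \<alpha> (at s)) (vector_derivative \<beta> (at t)) \<noteq> 0) \<and>
        regular_parametrization S (I \<times> J) (\<lambda>(s, t). \<alpha> s + \<beta> t) \<and>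
        q \<in> (\<lambda>(s, t). \<alpha> s + \<beta> t) ` (I \<times> J))"

text \<open>A surface that is a union of non-degenerate open line segments (the rulings), all parallel
  to one fixed direction \<open>w\<close>; the segment through \<open>q\<close> is \<open>{a + t w | 0 < t < l}\<close>.\<close>

definition cylindrical_surface :: "(real^3) set \<Rightarrow> bool" where
  "cylindrical_surface W \<longleftrightarrow>
     regular_surface W \<and>
     (\<exists>w. w \<noteq> 0 \<and>
        (\<forall>q\<in>W. \<exists>a l. l > 0 \<and> q \<in> open_segment a (a + l *\<^sub>R w) \<and> open_segment a (a + l *\<^sub>R w) \<subseteq> W))"

definition locally_cylindrical :: "(real^3) set \<Rightarrow> bool" where
  "locally_cylindrical S \<longleftrightarrow>
     (\<forall>q\<in>S. \<exists>W. openin (top_of_set S) W \<and> q \<in> W \<and> cylindrical_surface W)"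

end

theory Submission
  imports Defs "HOL-Computational_Algebra.Polynomial"
begin

text \<open>
  Write \<open>a = \<alpha>'\<close>, \<open>b = \<beta>'\<close>. A translation patch has curvature \<open>K\<close> iff
  \<open>det(a, a', b) det(b, b', a) = - K |a \<times> b|\<^sup>4\<close>.

  If \<open>K \<noteq> 0\<close>, fix \<open>s\<close> and describe the direction of \<open>b(t)\<close> by its affine coordinates \<open>(v, u)\<close> in
  an orthonormal frame adapted to \<open>a(s)\<close>, \<open>a'(s)\<close>. The logarithmic \<open>s\<close>-derivative of the
  relation is a linear differential equation for \<open>v\<close> as a function of \<open>u\<close>. With
  \<open>z = 2v/(1 + u\<^sup>2) - k\<close>, the second one becomes a quadratic equation for \<open>z\<close> with coefficients
  rational in \<open>u\<close>; differentiating it along the curve gives a second quadratic equation.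
  The resultant of the two, made polynomial in \<open>u\<close>, takes the value \<open>-2304\<close> at \<open>u = \<i>\<close>
  whatever the parameters are, so it does not vanish on an interval of values of \<open>u\<close>.

  If \<open>K = 0\<close>, then \<open>a \<times> a'\<close> and \<open>b \<times> b'\<close> are parallel wherever both are nonzero, so one generating
  curve is straight or both lie in parallel planes.

  Conversely, let \<open>w\<close> be the direction of the rulings. The normal \<open>N = X\<^sub>u \<times> X\<^sub>v\<close> satisfies
  \<open>N \<bullet> w = 0\<close>; differentiating this gives a nonzero kernel vector of the second fundamental form.
  A transversal curve \<open>\<alpha>\<close> in the surface gives the translation patch \<open>\<alpha>(s) + t w\<close>.
\<close>

subsection \<open>The jet equations and their resultant\<close>

text \<open>This is the vanishing of the Sylvester resultant, forced by the common root
  \<open>z\<close>. Being a polynomial consequence, it also covers vanishing leading coefficients,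
  as happens below at \<open>u = 0\<close>.\<close>

lemma resultant_of_quadratics:
  fixes a1 b1 c1 a2 b2 c2 z :: real
  assumes "a1 * z^2 + b1 * z + c1 = 0" "a2 * z^2 + b2 * z + c2 = 0"
  shows "(a1 * c2 - a2 * c1)^2 = (a1 * b2 - a2 * b1) * (b1 * c2 - b2 * c1)"
  using assms by algebra

text \<open>For such \<open>u\<close> the resultant of two quadratics in \<open>z\<close> vanishes.
  Multiplied by \<open>(1 + u^2)^2\<close> it is a polynomial in \<open>u\<close>, and evaluation at
  the imaginary unit shows that it is not the zero polynomial.\<close>

lemma finite_common_zeros:
  fixes P g h :: real
  shows "finite {u::real. \<exists>z.
     (1 + 3*u^2) * z^2 - 4*P*u*z + h*u + g + 4 / (1 + u^2) = 0 \<and>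
     u*(10 + 18*u^2) * z^2 - 8*P*(1 + 3*u^2)*z + 8*P^2*u + h*(1 + u^2) - 8*u / (1 + u^2) = 0}"
    (is "finite ?Z")
proof -
  let ?c = "complex_of_real"
  define q where "q = [:1, 0, 1::complex:]"
  define a1 where "a1 = [:1, 0, 3::complex:]"
  define b1 where "b1 = [:0, ?c (-4*P):]"
  \<comment> \<open>\<open>c1\<close> and \<open>c2\<close> are the constant coefficients multiplied
    by \<open>q\<close>, which removes their poles. Since the other coefficients are not rescaled,
    the second product in \<open>p\<close> carries one extra factor \<open>q\<close>.\<close>
  define c1 where "c1 = q * [:?c g, ?c h:] + [:4:]"
  define a2 where "a2 = [:0, 10, 0, 18::complex:]"
  define b2 where "b2 = smult (?c (-8*P)) a1"
  define c2 where "c2 = q * ([:0, ?c (8*P^2):] + smult (?c h) q) + [:0, -8:]"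
  define p where "p = (a1 * c2 - a2 * c1)^2 - q * ((a1 * b2 - a2 * b1) * (b1 * c2 - b2 * c1))"
  \<comment> \<open>At this root of \<open>q\<close> every term with \<open>P\<close>,
    \<open>g\<close> or \<open>h\<close> drops out: \<open>a1 = -2\<close>,
    \<open>a2 = -8 i\<close>, \<open>c1 = 4\<close>, \<open>c2 = -8 i\<close>, so \<open>p\<close>
    becomes \<open>(48 i)^2\<close>.\<close>
  have "poly q \<i> = 0" by (simp add: q_def)
  then have "poly p \<i> = -2304"
    unfolding p_def by (simp add: a1_def c2_def a2_def c1_def power2_eq_square algebra_simps)
  then have "p \<noteq> 0" by auto
  have zero: "poly p (?c u) = 0" if "u \<in> ?Z" for u
  proof -
    let ?q = "1 + u^2"
    have q0: "?q \<noteq> 0" by (metis add_pos_nonneg less_irrefl zero_le_power2 zero_less_one)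
    obtain z where "(1 + 3*u^2) * z^2 - 4*P*u*z + h*u + g + 4 / ?q = 0"
      "u*(10 + 18*u^2) * z^2 - 8*P*(1 + 3*u^2)*z + 8*P^2*u + h*?q - 8*u / ?q = 0"
      using \<open>u \<in> ?Z\<close> by blast
    then have z: "(1 + 3*u^2) * z^2 + (-4*P*u)*z + (h*u + g + 4 / ?q) = 0"
      "u*(10 + 18*u^2) * z^2 + (-8*P*(1 + 3*u^2))*z + (8*P^2*u + h*?q - 8*u / ?q) = 0"
      by (simp_all add: algebra_simps)
    define C1 where "C1 = ?q*(h*u + g) + 4"
    define C2 where "C2 = ?q*(8*P^2*u + h*?q) - 8*u"
    have C1: "h*u + g + 4 / ?q = C1 / ?q" and C2: "8*P^2*u + h*?q - 8*u / ?q = C2 / ?q"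
      using q0 by (simp_all add: C1_def C2_def field_simps)
    define x1 x2 x3 x4 where x: "x1 = 1 + 3*u^2" "x2 = -4*P*u" "x3 = u*(10 + 18*u^2)" "x4 = -8*P*(1 + 3*u^2)"
    have "(x1 * (C2/?q) - x3 * (C1/?q))^2 = (x1 * x4 - x3 * x2) * (x2 * (C2/?q) - x4 * (C1/?q))"
      using resultant_of_quadratics[OF z] unfolding C1 C2 x by (simp only: )
    then have "((x1 * C2 - x3 * C1)/?q)^2 = (x1 * x4 - x3 * x2) * ((x2 * C2 - x4 * C1)/?q)"
      by (simp add: diff_divide_distrib)
    then have "(x1 * C2 - x3 * C1)^2 = ?q * ((x1 * x4 - x3 * x2) * (x2 * C2 - x4 * C1))"
      using q0 by (simp add: power_divide divide_simps power2_eq_square)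
    then have *: "(x1 * C2 - x3 * C1)^2 - ?q * ((x1 * x4 - x3 * x2) * (x2 * C2 - x4 * C1)) = 0" by simp
    have "poly q (?c u) = ?c ?q" "poly a1 (?c u) = ?c x1" "poly b1 (?c u) = ?c x2" "poly a2 (?c u) = ?c x3"
      "poly b2 (?c u) = ?c x4" "poly c1 (?c u) = ?c C1" "poly c2 (?c u) = ?c C2"
      unfolding q_def a1_def b1_def a2_def b2_def c1_def c2_def x C1_def C2_def
      by (simp_all add: power2_eq_square algebra_simps)
    then have "poly p (?c u) = ?c ((x1 * C2 - x3 * C1)^2 - ?q * ((x1 * x4 - x3 * x2) * (x2 * C2 - x4 * C1)))"
      unfolding p_def by simp
    then show ?thesis using * by simp
  qed
  have "finite (?c ` ?Z)"
    by (rule finite_subset[OF _ poly_roots_finite[OF \<open>p \<noteq> 0\<close>]]) (use zero in blast)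
  then show ?thesis by (rule finite_imageD) (simp add: inj_on_def)
qed

text \<open>Here \<open>(A, 0, 0)\<close>, \<open>(\<mu>\<tau>A, \<tau>A, 0)\<close>, \<open>\<tau>\<^sup>2A (\<beta>, L, k)\<close>, \<open>\<tau>\<^sup>3A (\<dots>, \<gamma>, \<delta>)\<close> is the 3-jet of the tangent of
  one generating curve in an adapted frame, \<open>y (v, u, 1)\<close> is the tangent \<open>b\<close> of the other one
  and \<open>e (1, r, - v - u r)\<close> is \<open>b \<times> b'\<close>.\<close>

lemma jet_first:
  fixes A \<tau> \<mu> L k u v r y e :: real
  assumes nz: "A \<noteq> 0" "\<tau> \<noteq> 0" "y \<noteq> 0" "e \<noteq> 0"
    and D1: "D1 = A^2*\<tau>*y" "D1s = A^2*\<tau>^2*(L - k*u)*y"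
    and D2: "D2 = A*e" "D2s = \<tau>*A*e*(\<mu> + r)"
    and w: "w = A^2*y^2*(1 + u^2)" "ws = 2*A^2*\<tau>*y^2*(\<mu>*(1 + u^2) - u * v)"
    and eq: "w * (D1s*D2 + D1*D2s) = 2 * ws * (D1*D2)"
  shows "r = 3*\<mu> - L + k*u - 4*u * v / (1 + u^2)"
proof -
  \<comment> \<open>\<open>eq\<close> is the logarithmic derivative of
    \<open>D1 * D2 = \<kappa> * w^2\<close> without denominators. Up to a nonzero monomial it is
    linear in \<open>r\<close> and \<open>v\<close>; along the curve \<open>r = - dv/du\<close>, so
    it is a linear differential equation.\<close>
  have "A^5*\<tau>^2*y^3*e * ((1 + u^2) * (L - k*u + \<mu> + r) - 4 * (\<mu>*(1 + u^2) - u * v)) = 0"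
    using eq unfolding D1 D2 w by algebra
  then have *: "(1 + u^2) * (L - k*u + \<mu> + r) = 4 * (\<mu>*(1 + u^2) - u * v)"
    using nz by simp
  have q0: "1 + u^2 \<noteq> 0" by (metis add_pos_nonneg less_irrefl zero_le_power2 zero_less_one)
  have "L - k*u + \<mu> + r = 4 * \<mu> - 4*u * v / (1 + u^2)"
    using * q0 by (simp add: field_simps)
  then show ?thesis by simp
qed

text \<open>\<open>eq\<close> is the second derivative of \<open>D1 * D2 = \<kappa> * w^2\<close>,
  multiplied by \<open>w^2\<close> to eliminate \<open>\<kappa>\<close>. Inserting the linear
  equation for \<open>r\<close> leaves a quadratic in \<open>v\<close>. The shift by
  \<open>k\<close> in \<open>z\<close> absorbs the term \<open>k*u\<close>: along the curve
  \<open>dz/du = (2*u*z - 2*P) / (1 + u^2)\<close>.\<close>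

lemma jet_second:
  fixes A \<tau> \<mu> L k u v r y e \<beta> \<gamma> \<delta> P h g :: real
  assumes nz: "A \<noteq> 0" "\<tau> \<noteq> 0" "y \<noteq> 0" "e \<noteq> 0"
    and D1: "D1 = A^2*\<tau>*y" "D1s = A^2*\<tau>^2*(L - k*u)*y"
      "D1ss = A^2*\<tau>^3*y*(k * v - \<mu>*k*u + (\<mu>*L - \<beta>) + (\<gamma> - \<delta>*u))"
    and D2: "D2 = A*e" "D2s = \<tau>*A*e*(\<mu> + r)" "D2ss = \<tau>^2*A*e*(\<beta> + L*r - k*(v + u*r))"
    and w: "w = A^2*y^2*(1 + u^2)" "ws = 2*A^2*\<tau>*y^2*(\<mu>*(1 + u^2) - u * v)"
      "wss = 2*A^2*\<tau>^2*y^2*((\<mu>^2 + 1 + \<beta>)*(1 + u^2 + v^2) - (\<mu> * v + u)^2 - v *(\<beta> * v + L*u + k))"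
    and eq: "w^2 * (D1ss*D2 + 2*D1s*D2s + D1*D2ss) = 2 * (ws^2 + w*wss) * (D1*D2)"
    and r: "r = 3*\<mu> - L + k*u - 4*u * v / (1 + u^2)"
    and P: "P = 3*\<mu> - L"
    and z: "z = 2 * v / (1 + u^2) - k"
    and h: "h = \<mu>*k + \<delta> - 2*L*k - (L - 2*\<mu>)*k - P*k"
    and g: "g = P^2 - k^2 - (\<mu>*L - \<beta> + \<gamma> - L^2 + 3*\<mu>^2 - 3*\<beta> + (L - 2*\<mu>)*P)"
  shows "(1 + 3*u^2) * z^2 - 4*P*u*z + h*u + g + 4 / (1 + u^2) = 0"
proof -
  define q where "q = 1 + u^2"
  have q0: "q \<noteq> 0" unfolding q_def by (metis add_pos_nonneg less_irrefl zero_le_power2 zero_less_one)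
  define p where "p = v / q"
  have v: "v = p * q" using q0 by (simp add: p_def)
  have r': "r = 3*\<mu> - L + k*u - 4*u*p" using r by (simp add: p_def q_def)
  have z': "z = 2*p - k" using z by (simp add: p_def q_def)
  \<comment> \<open>\<open>X\<close> is the difference of the two sides of \<open>eq\<close> with
    the monomial \<open>A^7*\<tau>^3*y^5*e\<close> divided out.\<close>
  define X where "X = q^2 * ((k * v - \<mu>*k*u + (\<mu>*L - \<beta>) + (\<gamma> - \<delta>*u)) + 2*(L - k*u)*(\<mu> + r)
      + (\<beta> + L*r - k*(v + u*r)))
    - 2 * ((2*(\<mu>*q - u * v))^2
      + q * (2*((\<mu>^2 + 1 + \<beta>)*(q + v^2) - (\<mu> * v + u)^2 - v *(\<beta> * v + L*u + k))))"
  have "A^7*\<tau>^3*y^5*e * X = w^2 * (D1ss*D2 + 2*D1s*D2s + D1*D2ss) - 2 * (ws^2 + w*wss) * (D1*D2)"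
    unfolding D1 D2 w X_def q_def by algebra
  then have "X = 0" using nz eq by simp
  \<comment> \<open>After \<open>v = p * q\<close> everything is polynomial in \<open>p\<close>,
    \<open>u\<close> and the jet coefficients, and a factor \<open>q\<close> splits off.\<close>
  moreover have "X = - (q * (q * ((1 + 3*u^2) * z^2 - 4*P*u*z + h*u + g) + 4))"
    unfolding X_def h g P r' z' v q_def by algebra
  ultimately have "q * ((1 + 3*u^2) * z^2 - 4*P*u*z + h*u + g) + 4 = 0" using q0 by simp
  then have "(1 + 3*u^2) * z^2 - 4*P*u*z + h*u + g + 4 / q = 0"
    using q0 by (simp add: field_simps)
  then show ?thesis unfolding q_def .
qed

text \<open>A continuous function with finitely many values on an interval is constant there, which
  a nonzero derivative forbids.\<close>

lemma deriv_nonzero_infinite_image: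
  fixes f f' :: "real \<Rightarrow> real"
  assumes J: "open J" "is_interval J" "J \<noteq> {}"
    and f: "\<And>t. t \<in> J \<Longrightarrow> (f has_real_derivative f' t) (at t)"
    and nz: "\<And>t. t \<in> J \<Longrightarrow> f' t \<noteq> 0"
  shows "infinite (f ` J)"
proof
  assume fin: "finite (f ` J)"
  have "continuous_on J f"
    using f by (meson DERIV_isCont continuous_at_imp_continuous_on)
  then have "f constant_on J"
    using fin J(2) by (intro continuous_finite_range_constant) (auto simp: is_interval_connected_1)
  then obtain c where c: "\<And>t. t \<in> J \<Longrightarrow> f t = c" by (auto simp: constant_on_def)
  obtain t where t: "t \<in> J" using J(3) by blast
  have "(f has_real_derivative 0) (at t)"
    by (rule has_field_derivative_transform_within_open[of "\<lambda>_. c" _ _ J]) (use c t J(1) in auto)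
  then show False using f[OF t] nz[OF t] DERIV_unique by blast
qed

text \<open>Only the 3-jet of one tangent at a single parameter enters, while \<open>t\<close> runs
  through \<open>J\<close>. Two quadratics for \<open>z\<close> with coefficients in
  \<open>u\<close> hold at every \<open>t\<close>; as \<open>u\<close> has nonzero derivative, it
  takes infinitely many values, against \<open>finite_common_zeros\<close>.\<close>

lemma adapted_jet_contradiction:
  fixes a0 a1 a2 a3 :: "real^3" and b b' :: "real \<Rightarrow> real^3"
  assumes frame: "a0$2 = 0" "a0$3 = 0" "a1$3 = 0"
    and J: "open J" "is_interval J" "J \<noteq> {}"
    and b: "\<And>t. t \<in> J \<Longrightarrow> (b has_vector_derivative b' t) (at t)"
    and D1: "\<And>t. t \<in> J \<Longrightarrow> D1 t = cross3 a0 a1 \<bullet> b t"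
      "\<And>t. t \<in> J \<Longrightarrow> D1s t = cross3 a0 a2 \<bullet> b t"
      "\<And>t. t \<in> J \<Longrightarrow> D1ss t = (cross3 a1 a2 + cross3 a0 a3) \<bullet> b t"
    and D2: "\<And>t. t \<in> J \<Longrightarrow> D2 t = cross3 (b t) (b' t) \<bullet> a0"
      "\<And>t. t \<in> J \<Longrightarrow> D2s t = cross3 (b t) (b' t) \<bullet> a1"
      "\<And>t. t \<in> J \<Longrightarrow> D2ss t = cross3 (b t) (b' t) \<bullet> a2"
    and w: "\<And>t. t \<in> J \<Longrightarrow> w t = (a0 \<bullet> a0) * (b t \<bullet> b t) - (a0 \<bullet> b t)^2"
      "\<And>t. t \<in> J \<Longrightarrow> ws t = 2 * ((a0 \<bullet> a1) * (b t \<bullet> b t) - (a0 \<bullet> b t) * (a1 \<bullet> b t))"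
      "\<And>t. t \<in> J \<Longrightarrow> wss t = 2 * ((a1 \<bullet> a1 + a0 \<bullet> a2) * (b t \<bullet> b t) - (a1 \<bullet> b t)^2
         - (a0 \<bullet> b t) * (a2 \<bullet> b t))"
    and nz: "\<And>t. t \<in> J \<Longrightarrow> D1 t \<noteq> 0" "\<And>t. t \<in> J \<Longrightarrow> D2 t \<noteq> 0"
    and eq1: "\<And>t. t \<in> J \<Longrightarrow> w t * (D1s t * D2 t + D1 t * D2s t) = 2 * ws t * (D1 t * D2 t)"
    and eq2: "\<And>t. t \<in> J \<Longrightarrow> (w t)^2 * (D1ss t * D2 t + 2 * D1s t * D2s t + D1 t * D2ss t)
        = 2 * ((ws t)^2 + w t * wss t) * (D1 t * D2 t)"
  shows False
proof -
  define A where "A = a0$1"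
  define \<tau> where "\<tau> = a1$2 / A"
  obtain t0 where t0: "t0 \<in> J" using J(3) by blast
  have D1': "D1 t = A * (a1$2) * b t $ 3" if "t \<in> J" for t
    using D1(1)[OF that] frame by (simp add: A_def cross3_simps)
  have nzA: "A \<noteq> 0" "a1$2 \<noteq> 0" using D1'[OF t0] nz(1)[OF t0] by auto
  then have nz\<tau>: "\<tau> \<noteq> 0" by (simp add: \<tau>_def)
  \<comment> \<open>The derivative of order \<open>j\<close> is measured in units of
    \<open>\<tau>^j * A\<close>; the powers of \<open>A\<close> and \<open>\<tau>\<close> then
    factor out of the jet equations.\<close>
  define \<mu> L k \<beta> \<gamma> \<delta> where defs: "\<mu> = a1$1 / (\<tau>*A)" "L = a2$2 / (\<tau>^2*A)" "k = a2$3 / (\<tau>^2*A)"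
    "\<beta> = a2$1 / (\<tau>^2*A)" "\<gamma> = a3$2 / (\<tau>^3*A)" "\<delta> = a3$3 / (\<tau>^3*A)"
  have a: "a0$1 = A" "a1$1 = \<mu>*(\<tau>*A)" "a1$2 = \<tau>*A" "a2$1 = \<beta>*(\<tau>^2*A)" "a2$2 = L*(\<tau>^2*A)"
    "a2$3 = k*(\<tau>^2*A)" "a3$2 = \<gamma>*(\<tau>^3*A)" "a3$3 = \<delta>*(\<tau>^3*A)"
    using nzA nz\<tau> by (simp_all add: defs A_def) (simp add: \<tau>_def A_def)
  define y where "y t = b t $ 3" for t
  define u where "u t = b t $ 2 / y t" for t
  define v where "v t = b t $ 1 / y t" for t
  define e where "e t = cross3 (b t) (b' t) $ 1" for t
  define r where "r t = cross3 (b t) (b' t) $ 2 / e t" for t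
  define P where "P = 3*\<mu> - L"
  define z where "z t = 2 * v t / (1 + (u t)^2) - k" for t
  define h where "h = \<mu>*k + \<delta> - 2*L*k - (L - 2*\<mu>)*k - P*k"
  define g where "g = P^2 - k^2 - (\<mu>*L - \<beta> + \<gamma> - L^2 + 3*\<mu>^2 - 3*\<beta> + (L - 2*\<mu>)*P)"
  have nzy: "y t \<noteq> 0" if "t \<in> J" for t using D1'[OF that] nz(1)[OF that] by (auto simp: y_def)
  have nze: "e t \<noteq> 0" if "t \<in> J" for t
    using D2(1)[OF that] nz(2)[OF that] frame by (auto simp: e_def inner_vec_def sum_3)
  have bt: "b t $ 1 = v t * y t" "b t $ 2 = u t * y t" "b t $ 3 = y t" if "t \<in> J" for t
    using nzy[OF that] by (simp_all add: u_def v_def y_def)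
  have et: "cross3 (b t) (b' t) $ 1 = e t" "cross3 (b t) (b' t) $ 2 = r t * e t"
    "cross3 (b t) (b' t) $ 3 = - (v t + u t * r t) * e t" if "t \<in> J" for t
  proof -
    show 1: "cross3 (b t) (b' t) $ 1 = e t" "cross3 (b t) (b' t) $ 2 = r t * e t"
      using nze[OF that] by (simp_all add: r_def e_def)
    \<comment> \<open>Orthogonality to \<open>b\<close> determines the third coordinate from the
      first two.\<close>
    have "cross3 (b t) (b' t) \<bullet> b t = 0" by (simp add: dot_cross_self)
    then have "y t * (v t * e t + u t * r t * e t + cross3 (b t) (b' t) $ 3) = 0"
      unfolding inner_vec_def sum_3 1 bt[OF that] by (simp add: algebra_simps)
    then have "v t * e t + u t * r t * e t + cross3 (b t) (b' t) $ 3 = 0"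
      using nzy[OF that] by (simp only: mult_eq_0_iff) simp
    then show "cross3 (b t) (b' t) $ 3 = - (v t + u t * r t) * e t"
      by (simp add: algebra_simps)
  qed
  have J1: "D1 t = A^2*\<tau>*y t" "D1s t = A^2*\<tau>^2*(L - k*u t)*y t"
      "D1ss t = A^2*\<tau>^3*y t*(k * v t - \<mu>*k*u t + (\<mu>*L - \<beta>) + (\<gamma> - \<delta>*u t))" if "t \<in> J" for t
    unfolding D1[OF that] cross3_def inner_vec_def sum_3 using frame
    by (simp_all add: a bt[OF that] algebra_simps power2_eq_square power3_eq_cube)
  have J2: "D2 t = A*e t" "D2s t = \<tau>*A*e t*(\<mu> + r t)"
      "D2ss t = \<tau>^2*A*e t*(\<beta> + L*r t - k*(v t + u t*r t))" if "t \<in> J" for t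
    unfolding D2[OF that] inner_vec_def sum_3 using frame
    by (simp_all add: a et[OF that] algebra_simps)
  have Jw: "w t = A^2*(y t)^2*(1 + (u t)^2)"
    "ws t = 2*A^2*\<tau>*(y t)^2*(\<mu>*(1 + (u t)^2) - u t * v t)"
    "wss t = 2*A^2*\<tau>^2*(y t)^2*((\<mu>^2 + 1 + \<beta>)*(1 + (u t)^2 + (v t)^2) - (\<mu> * v t + u t)^2
       - v t * (\<beta> * v t + L*u t + k))" if "t \<in> J" for t
    unfolding w[OF that] inner_vec_def sum_3 using frame
    by (simp_all add: a bt[OF that] algebra_simps power2_eq_square)
  have r: "r t = 3*\<mu> - L + k*u t - 4*u t * v t / (1 + (u t)^2)" if "t \<in> J" for t
    by (rule jet_first[OF nzA(1) nz\<tau> nzy nze J1(1,2) J2(1,2) Jw(1,2) eq1]) (rule that)+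
  have E1: "(1 + 3*(u t)^2) * (z t)^2 - 4*P*u t*z t + h*u t + g + 4 / (1 + (u t)^2) = 0" if "t \<in> J" for t
    by (rule jet_second[OF nzA(1) nz\<tau> nzy nze J1 J2 Jw eq2 r P_def z_def h_def g_def]) (rule that)+
  \<comment> \<open>Quotient rule for \<open>b$2 / b$3\<close>: the numerator is minus the first
    coordinate of \<open>cross3 b b'\<close>. The same rule for \<open>v\<close> produces the second
    coordinate, whence \<open>v' = - r * u'\<close>.\<close>
  define u' where "u' t = - e t / (y t)^2" for t
  have bd: "((\<lambda>t. b t $ i) has_real_derivative b' t $ i) (at t)" if "t \<in> J" for t i
    using b[OF that] by (simp add: has_real_derivative_iff_has_vector_derivative
        bounded_linear.has_vector_derivative[OF bounded_linear_vec_nth])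
  have du: "(u has_real_derivative u' t) (at t)" and dv: "(v has_real_derivative - r t * u' t) (at t)"
    if "t \<in> J" for t
  proof -
    have "r t * e t = b t $ 3 * b' t $ 1 - b t $ 1 * b' t $ 3"
      using et(2)[OF that] by (simp add: cross3_simps)
    then show "(u has_real_derivative u' t) (at t)" "(v has_real_derivative - r t * u' t) (at t)"
      using nzy[OF that]
      unfolding u_def[abs_def] v_def[abs_def] u'_def y_def
      by (auto intro!: derivative_eq_intros bd[OF that] simp: e_def cross3_simps power2_eq_square field_simps)
  qed
  have dz: "(z has_real_derivative (2*u t*z t - 2*P) / (1 + (u t)^2) * u' t) (at t)" if "t \<in> J" for t
  proof -
    have q0: "1 + (u t)^2 \<noteq> 0" by (metis add_pos_nonneg less_irrefl zero_le_power2 zero_less_one)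
    have "(z has_real_derivative (2 * (- r t * u' t) * (1 + (u t)^2) - 2 * v t * (2 * u t * u' t)) / (1 + (u t)^2)^2) (at t)"
      unfolding z_def[abs_def]
      by (rule derivative_eq_intros du[OF that] dv[OF that] refl q0 | simp add: power2_eq_square)+
    \<comment> \<open>Inserting the linear equation for \<open>r\<close> turns the quotient rule
      into a linear equation for \<open>z\<close> in which \<open>k\<close> no longer
      occurs.\<close>
    moreover have "(2 * (- r t * u' t) * (1 + (u t)^2) - 2 * v t * (2 * u t * u' t)) / (1 + (u t)^2)^2
       = (2*u t*z t - 2*P) / (1 + (u t)^2) * u' t"
    proof -
      define q where "q = 1 + (u t)^2"
      have "q \<noteq> 0" using q0 by (simp add: q_def)
      define p where "p = v t / q"
      have v: "v t = p * q" using \<open>q \<noteq> 0\<close> by (simp add: p_def)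
      have r': "r t = P + k*u t - 4*u t*p" using r[OF that] by (simp add: P_def p_def q_def)
      have z': "z t = 2*p - k" by (simp add: z_def p_def q_def)
      show ?thesis unfolding q_def[symmetric] r' z' v using \<open>q \<noteq> 0\<close>
        by (simp add: divide_simps) algebra
    qed
    ultimately show ?thesis by simp
  qed
  have E2: "u t*(10 + 18*(u t)^2) * (z t)^2 - 8*P*(1 + 3*(u t)^2)*z t + 8*P^2*u t + h*(1 + (u t)^2)
      - 8*u t / (1 + (u t)^2) = 0" (is "?E2 = 0") if "t \<in> J" for t
  proof -
    define q where "q = 1 + (u t)^2"
    have q0: "q \<noteq> 0" unfolding q_def by (metis add_pos_nonneg less_irrefl zero_le_power2 zero_less_one)
    define z' where "z' = (2*u t*z t - 2*P) / q * u' t"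
    \<comment> \<open>\<open>F\<close> is the left side of \<open>E1\<close>. It vanishes on
      \<open>J\<close>, hence so does its derivative, and dividing that by \<open>u' / q\<close>
      gives the second quadratic.\<close>
    define F where "F = (\<lambda>t. (1 + 3*(u t)^2) * (z t)^2 - 4*P*u t*z t + h*u t + g + 4 / (1 + (u t)^2))"
    have dz': "(z has_real_derivative z') (at t)" using dz[OF that] by (simp add: z'_def q_def)
    have "(F has_real_derivative
       6*u t*u' t*(z t)^2 + (1 + 3*(u t)^2)*(2*z t*z') - 4*P*(u' t*z t + u t*z') + h*u' t
         - 8*u t*u' t / q^2) (at t)"
      unfolding F_def
      using q0 by (auto intro!: derivative_eq_intros du[OF that] dz' simp: q_def[symmetric])
        (simp add: field_simps power2_eq_square)
    moreover have "(F has_real_derivative 0) (at t)"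
      by (rule has_field_derivative_transform_within_open[of "\<lambda>_. 0" _ _ J])
        (use E1 that J(1) in \<open>auto simp: F_def\<close>)
    ultimately have "6*u t*u' t*(z t)^2 + (1 + 3*(u t)^2)*(2*z t*z') - 4*P*(u' t*z t + u t*z') + h*u' t
         - 8*u t*u' t / q^2 = 0" using DERIV_unique by blast
    moreover have "6*u t*u' t*(z t)^2 + (1 + 3*(u t)^2)*(2*z t*z') - 4*P*(u' t*z t + u t*z') + h*u' t
         - 8*u t*u' t / q^2 = u' t / q * ?E2"
    proof -
      \<comment> \<open>Treating \<open>1/q\<close> as a variable \<open>i\<close> with
        \<open>i * q = 1\<close> makes the identity polynomial.\<close>
      define i where "i = 1/q"
      have i: "i * q = 1" using q0 by (simp add: i_def)
      have d: "x / q = x * i" "x / q^2 = x * i^2" for x by (simp_all add: i_def power_divide)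
      show ?thesis unfolding z'_def q_def[symmetric] d using i unfolding q_def by algebra
    qed
    moreover have "u' t / q \<noteq> 0" using nze[OF that] nzy[OF that] q0 by (simp add: u'_def)
    ultimately show ?thesis by simp
  qed
  have "infinite (u ` J)"
    by (rule deriv_nonzero_infinite_image[OF J du]) (use nze nzy in \<open>auto simp: u'_def\<close>)
  moreover have "finite (u ` J)"
    by (rule finite_subset[OF _ finite_common_zeros[of P h g]]) (use E1 E2 in blast)
  ultimately show False by blast
qed

section \<open>Differentiating the curvature relation and choosing the frame\<close>

lemma bounded_bilinear_cross3: "bounded_bilinear cross3"
  using bilinear_conv_bounded_bilinear bilinear_cross by blast

lemma has_vector_derivative_cross3:
  assumes "(f has_vector_derivative f') (at s)" "(g has_vector_derivative g') (at s)"
  shows "((\<lambda>s. cross3 (f s) (g s)) has_vector_derivative cross3 (f s) g' + cross3 f' (g s)) (at s)"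
  using bounded_bilinear.has_vector_derivative[OF bounded_bilinear_cross3 assms] by simp

lemma has_real_derivative_inner:
  assumes "(f has_vector_derivative f') (at s)" "(g has_vector_derivative g') (at s)"
  shows "((\<lambda>s. f s \<bullet> g s) has_real_derivative f s \<bullet> g' + f' \<bullet> g s) (at s)"
  using bounded_bilinear.has_vector_derivative[OF bounded_bilinear_inner assms]
  by (simp add: has_real_derivative_iff_has_vector_derivative)

text \<open>Lagrange's identity, squared. The Gram determinant is polynomial in the vectors, so the
  right side can be differentiated by the product rule.\<close>

lemma norm_cross3_power4:
  "(norm (cross3 x y))^4 = ((x \<bullet> x) * (y \<bullet> y) - (x \<bullet> y)^2)^2"
proof -
  have "(norm (cross3 x y))^2 = (x \<bullet> x) * (y \<bullet> y) - (x \<bullet> y)^2"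
    using norm_cross_dot[of x y] by (simp add: power_mult_distrib power2_norm_eq_inner)
  then have "((norm (cross3 x y))^2)^2 = ((x \<bullet> x) * (y \<bullet> y) - (x \<bullet> y)^2)^2" by simp
  then show ?thesis by (simp flip: power_mult)
qed

text \<open>Comparing \<open>D1 * D2 = \<kappa> * w^2\<close> with its first two
  \<open>s\<close>-derivatives at \<open>s0\<close>, where the frame is adapted, eliminates
  \<open>\<kappa>\<close>. Neither factor on the left can vanish, since \<open>\<kappa>\<close> and
  \<open>w\<close> do not.\<close>

lemma adapted_frame_contradiction:
  fixes a a1 a2 a3 b b' :: "real \<Rightarrow> real^3"
  assumes I: "open I" "s0 \<in> I" and J: "open J" "is_interval J" "J \<noteq> {}"
    and a: "\<And>s. s \<in> I \<Longrightarrow> (a has_vector_derivative a1 s) (at s)"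
      "\<And>s. s \<in> I \<Longrightarrow> (a1 has_vector_derivative a2 s) (at s)"
      "\<And>s. s \<in> I \<Longrightarrow> (a2 has_vector_derivative a3 s) (at s)"
    and b: "\<And>t. t \<in> J \<Longrightarrow> (b has_vector_derivative b' t) (at t)"
    and frame: "a s0 $ 2 = 0" "a s0 $ 3 = 0" "a1 s0 $ 3 = 0"
    and eq: "\<And>s t. s \<in> I \<Longrightarrow> t \<in> J \<Longrightarrow>
       (cross3 (a s) (a1 s) \<bullet> b t) * (cross3 (b t) (b' t) \<bullet> a s) = \<kappa> * (norm (cross3 (a s) (b t)))^4"
    and \<kappa>: "\<kappa> \<noteq> 0" and reg: "\<And>s t. s \<in> I \<Longrightarrow> t \<in> J \<Longrightarrow> cross3 (a s) (b t) \<noteq> 0"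
  shows False
proof -
  \<comment> \<open>The suffixes \<open>s\<close> and \<open>ss\<close> denote derivatives in
    \<open>s\<close>. \<open>D1s\<close> has a single term because
    \<open>cross3 (a1 s) (a1 s) = 0\<close>.\<close>
  define D1 where "D1 t s = cross3 (a s) (a1 s) \<bullet> b t" for t s
  define D1s where "D1s t s = cross3 (a s) (a2 s) \<bullet> b t" for t s
  define D1ss where "D1ss t s = (cross3 (a1 s) (a2 s) + cross3 (a s) (a3 s)) \<bullet> b t" for t s
  define D2 where "D2 t s = cross3 (b t) (b' t) \<bullet> a s" for t s
  define D2s where "D2s t s = cross3 (b t) (b' t) \<bullet> a1 s" for t s
  define D2ss where "D2ss t s = cross3 (b t) (b' t) \<bullet> a2 s" for t s
  define w where "w t s = (a s \<bullet> a s) * (b t \<bullet> b t) - (a s \<bullet> b t)^2" for t s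
  define ws where "ws t s = 2 * ((a s \<bullet> a1 s) * (b t \<bullet> b t) - (a s \<bullet> b t) * (a1 s \<bullet> b t))" for t s
  define wss where "wss t s = 2 * ((a1 s \<bullet> a1 s + a s \<bullet> a2 s) * (b t \<bullet> b t) - (a1 s \<bullet> b t)^2
         - (a s \<bullet> b t) * (a2 s \<bullet> b t))" for t s
  note cd = has_vector_derivative_const
  have dD1: "(D1 t has_real_derivative D1s t s) (at s)" and dD1s: "(D1s t has_real_derivative D1ss t s) (at s)"
    and dD2: "(D2 t has_real_derivative D2s t s) (at s)" and dD2s: "(D2s t has_real_derivative D2ss t s) (at s)"
    if "s \<in> I" for s t
    using has_real_derivative_inner[OF has_vector_derivative_cross3[OF a(1)[OF that] a(2)[OF that]] cd[of "b t"]]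
      has_real_derivative_inner[OF has_vector_derivative_cross3[OF a(1)[OF that] a(3)[OF that]] cd[of "b t"]]
      has_real_derivative_inner[OF cd[of "cross3 (b t) (b' t)"] a(1)[OF that]]
      has_real_derivative_inner[OF cd[of "cross3 (b t) (b' t)"] a(2)[OF that]]
    unfolding D1_def[abs_def] D1s_def[abs_def] D1ss_def D2_def[abs_def] D2s_def[abs_def] D2ss_def
    by (simp_all add: add.commute)
  have dw: "(w t has_real_derivative ws t s) (at s)" and dws: "(ws t has_real_derivative wss t s) (at s)"
    if "s \<in> I" for s t
    unfolding w_def[abs_def] ws_def[abs_def] wss_def
    by (auto intro!: derivative_eq_intros has_real_derivative_inner[OF a(1)[OF that] a(1)[OF that]]
      has_real_derivative_inner[OF a(1)[OF that] cd[of "b t"]]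
      has_real_derivative_inner[OF a(2)[OF that] cd[of "b t"]]
      has_real_derivative_inner[OF a(1)[OF that] a(2)[OF that]]
      simp: algebra_simps inner_commute power2_eq_square)
  have eq0: "D1 t s * D2 t s = \<kappa> * (w t s)^2" if "s \<in> I" "t \<in> J" for s t
    using eq[OF that] unfolding norm_cross3_power4 D1_def D2_def w_def .
  have transfer: "f' = g'" if "(f has_real_derivative f') (at s)" "(g has_real_derivative g') (at s)"
    "s \<in> I" "\<And>s. s \<in> I \<Longrightarrow> f s = g s" for f g :: "real \<Rightarrow> real" and f' g' s
    using has_field_derivative_transform_within_open[OF that(1) I(1) that(3)] that(2,4) DERIV_unique by blast
  have eqs1: "D1s t s * D2 t s + D1 t s * D2s t s = \<kappa> * (2 * w t s * ws t s)" if "s \<in> I" "t \<in> J" for s t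
  proof (rule transfer[OF _ _ \<open>s \<in> I\<close>])
    show "((\<lambda>s. D1 t s * D2 t s) has_real_derivative D1s t s * D2 t s + D1 t s * D2s t s) (at s)"
      by (auto intro!: derivative_eq_intros dD1[OF that(1)] dD2[OF that(1)])
    show "((\<lambda>s. \<kappa> * (w t s)^2) has_real_derivative \<kappa> * (2 * w t s * ws t s)) (at s)"
      by (auto intro!: derivative_eq_intros dw[OF that(1)])
  qed (use eq0 that in auto)
  have eqs2: "D1ss t s * D2 t s + 2 * D1s t s * D2s t s + D1 t s * D2ss t s = \<kappa> * (2 * ((ws t s)^2 + w t s * wss t s))"
    if "s \<in> I" "t \<in> J" for s t
  proof (rule transfer[OF _ _ \<open>s \<in> I\<close>])
    show "((\<lambda>s. D1s t s * D2 t s + D1 t s * D2s t s) has_real_derivative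
        D1ss t s * D2 t s + 2 * D1s t s * D2s t s + D1 t s * D2ss t s) (at s)"
      by (auto intro!: derivative_eq_intros dD1[OF that(1)] dD2[OF that(1)] dD1s[OF that(1)] dD2s[OF that(1)])
    show "((\<lambda>s. \<kappa> * (2 * w t s * ws t s)) has_real_derivative \<kappa> * (2 * ((ws t s)^2 + w t s * wss t s))) (at s)"
      by (auto intro!: derivative_eq_intros dw[OF that(1)] dws[OF that(1)] simp: power2_eq_square)
  qed (use eqs1 that in auto)
  have "w t s \<noteq> 0" if "s \<in> I" "t \<in> J" for s t
    using reg[OF that] norm_cross3_power4[of "a s" "b t"] unfolding w_def by (metis norm_eq_zero power_eq_0_iff zero_power2)
  then have nz: "D1 t s \<noteq> 0" "D2 t s \<noteq> 0" if "s \<in> I" "t \<in> J" for s t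
    using eq0[OF that] that \<kappa> by auto
  show False
  proof (rule adapted_jet_contradiction[OF frame J b, where ?D1.0 = "\<lambda>t. D1 t s0" and ?D1s = "\<lambda>t. D1s t s0"
      and ?D1ss = "\<lambda>t. D1ss t s0" and ?D2.0 = "\<lambda>t. D2 t s0" and ?D2s = "\<lambda>t. D2s t s0" and ?D2ss = "\<lambda>t. D2ss t s0"
      and w = "\<lambda>t. w t s0" and ws = "\<lambda>t. ws t s0" and wss = "\<lambda>t. wss t s0"])
    fix t assume t: "t \<in> J"
    show "w t s0 * (D1s t s0 * D2 t s0 + D1 t s0 * D2s t s0) = 2 * ws t s0 * (D1 t s0 * D2 t s0)"
      unfolding eqs1[OF I(2) t] eq0[OF I(2) t] by (simp add: power2_eq_square)
    show "(w t s0)^2 * (D1ss t s0 * D2 t s0 + 2 * D1s t s0 * D2s t s0 + D1 t s0 * D2ss t s0)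
      = 2 * ((ws t s0)^2 + w t s0 * wss t s0) * (D1 t s0 * D2 t s0)"
      unfolding eqs2[OF I(2) t] eq0[OF I(2) t] by simp
  qed (use nz I in \<open>simp_all add: D1_def D1s_def D1ss_def D2_def D2s_def D2ss_def w_def ws_def wss_def\<close>)
qed

text \<open>\<open>f\<close> takes coordinates in the orthonormal frame whose first vector is along
  \<open>x\<close> and whose third is along \<open>cross3 x y\<close>.\<close>

lemma adapted_rotation_exists:
  fixes x y :: "real^3"
  assumes "cross3 x y \<noteq> 0"
  obtains f :: "real^3 \<Rightarrow> real^3" where "orthogonal_transformation f" "f x $ 2 = 0" "f x $ 3 = 0" "f y $ 3 = 0"
proof -
  have x0: "x \<noteq> 0" using assms by auto
  define e1 where "e1 = x /\<^sub>R norm x"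
  define e3 where "e3 = cross3 x y /\<^sub>R norm (cross3 x y)"
  define f :: "real^3 \<Rightarrow> real^3" where "f v = vector [e1 \<bullet> v, cross3 e3 e1 \<bullet> v, e3 \<bullet> v]" for v
  have n: "e1 \<bullet> e1 = 1" "e3 \<bullet> e3 = 1" "e1 \<bullet> e3 = 0"
    using x0 assms by (simp_all add: e1_def e3_def dot_cross_self flip: power2_norm_eq_inner)
  \<comment> \<open>The squared triple product is the Gram determinant of \<open>e1\<close>,
    \<open>e3\<close>, \<open>v\<close>. For orthonormal \<open>e1\<close>, \<open>e3\<close> this
    is Parseval's identity.\<close>
  have gram: "(cross3 e3 e1 \<bullet> v)^2 = (e1\<bullet>e1)*(e3\<bullet>e3)*(v\<bullet>v) + 2*(e1\<bullet>e3)*(e3\<bullet>v)*(e1\<bullet>v)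
       - (e1\<bullet>v)^2*(e3\<bullet>e3) - (e3\<bullet>v)^2*(e1\<bullet>e1) - (e1\<bullet>e3)^2*(v\<bullet>v)" for v
    unfolding cross3_def inner_vec_def sum_3 by (simp add: vector_def) algebra
  have "norm (f v) = norm v" for v
  proof -
    have "f v \<bullet> f v = (e1 \<bullet> v)^2 + (cross3 e3 e1 \<bullet> v)^2 + (e3 \<bullet> v)^2"
      unfolding inner_vec_def[of "f v" "f v"] sum_3 by (simp add: f_def power2_eq_square)
    then have "f v \<bullet> f v = v \<bullet> v" using gram[of v] n by simp
    then show ?thesis by (simp add: norm_eq_sqrt_inner)
  qed
  moreover have "linear f"
    by (rule linearI) (simp_all add: f_def vec_eq_iff forall_3 inner_add_right)
  ultimately have "orthogonal_transformation f" by (simp add: orthogonal_transformation)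
  moreover have "f x $ 2 = 0" "f x $ 3 = 0" "f y $ 3 = 0"
    by (simp_all add: f_def e1_def e3_def cross_mult_left cross_mult_right dot_cross_self)
  ultimately show ?thesis by (rule that)
qed

text \<open>The relation is invariant under orthogonal maps: each triple product acquires the factor
  \<open>det (matrix f)\<close>, whose square is 1, and norms are kept. So the frame may be adapted
  to \<open>a s0\<close> and \<open>a1 s0\<close>, which are independent because the left side is
  nonzero.\<close>

lemma curvature_relation_contradiction:
  fixes a a1 a2 a3 b b' :: "real \<Rightarrow> real^3"
  assumes I: "open I" "I \<noteq> {}" and J: "open J" "is_interval J" "J \<noteq> {}"
    and a: "\<And>s. s \<in> I \<Longrightarrow> (a has_vector_derivative a1 s) (at s)"
      "\<And>s. s \<in> I \<Longrightarrow> (a1 has_vector_derivative a2 s) (at s)"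
      "\<And>s. s \<in> I \<Longrightarrow> (a2 has_vector_derivative a3 s) (at s)"
    and b: "\<And>t. t \<in> J \<Longrightarrow> (b has_vector_derivative b' t) (at t)"
    and eq: "\<And>s t. s \<in> I \<Longrightarrow> t \<in> J \<Longrightarrow>
       (cross3 (a s) (a1 s) \<bullet> b t) * (cross3 (b t) (b' t) \<bullet> a s) = \<kappa> * (norm (cross3 (a s) (b t)))^4"
    and \<kappa>: "\<kappa> \<noteq> 0" and reg: "\<And>s t. s \<in> I \<Longrightarrow> t \<in> J \<Longrightarrow> cross3 (a s) (b t) \<noteq> 0"
  shows False
proof -
  obtain s0 t0 where s0: "s0 \<in> I" and t0: "t0 \<in> J" using I J by blast
  have "cross3 (a s0) (a1 s0) \<noteq> 0"
    using eq[OF s0 t0] reg[OF s0 t0] \<kappa> by auto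
  then obtain f :: "real^3 \<Rightarrow> real^3" where f: "orthogonal_transformation f"
    and fr: "f (a s0) $ 2 = 0" "f (a s0) $ 3 = 0" "f (a1 s0) $ 3 = 0"
    by (rule adapted_rotation_exists)
  have lin: "linear f" using f by (simp add: orthogonal_transformation)
  then have bl: "bounded_linear f" by (simp add: linear_conv_bounded_linear)
  have inn: "f x \<bullet> f y = x \<bullet> y" for x y using f by (simp add: orthogonal_transformation_def)
  let ?d = "det (matrix f)"
  have cr: "cross3 (f x) (f y) = ?d *\<^sub>R f (cross3 x y)" for x y by (rule cross_orthogonal_transformation[OF f])
  have dd: "?d * ?d = 1"
    using det_orthogonal_matrix[of "matrix f"] f by (auto simp: orthogonal_transformation_matrix)
  have nf: "norm (f x) = norm x" for x using f by (simp add: orthogonal_transformation)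
  have nc: "norm (cross3 (f x) (f y)) = norm (cross3 x y)" for x y
  proof -
    have "\<bar>?d\<bar> = 1" using dd by (metis abs_mult_self_eq abs_ge_zero abs_1 power2_eq_square power2_eq_iff_nonneg zero_le_one abs_mult one_power2)
    then show ?thesis unfolding cr by (simp add: nf)
  qed
  have fd: "((\<lambda>s. f (g s)) has_vector_derivative f g') (at s)" if "(g has_vector_derivative g') (at s)" for g g' s
    by (rule bounded_linear.has_vector_derivative[OF bl that])
  show False
  proof (rule adapted_frame_contradiction[OF I(1) s0 J, where a = "\<lambda>s. f (a s)" and ?a1.0 = "\<lambda>s. f (a1 s)"
        and ?a2.0 = "\<lambda>s. f (a2 s)" and ?a3.0 = "\<lambda>s. f (a3 s)" and b = "\<lambda>t. f (b t)" and b' = "\<lambda>t. f (b' t)"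
        and \<kappa> = \<kappa>])
    fix s t assume st: "s \<in> I" "t \<in> J"
    show "cross3 (f (a s)) (f (a1 s)) \<bullet> f (b t) * (cross3 (f (b t)) (f (b' t)) \<bullet> f (a s)) =
           \<kappa> * norm (cross3 (f (a s)) (f (b t))) ^ 4"
      unfolding nc unfolding cr using eq[OF st] dd by (simp add: inn algebra_simps)
    show "cross3 (f (a s)) (f (b t)) \<noteq> 0"
      using reg[OF st] nc[of "a s" "b t"] by (metis norm_eq_zero)
  qed (use a b fr \<kappa> fd in auto)
qed

subsection \<open>Calculus of smooth maps\<close>

lemma Ck_on_cong:
  assumes "open U" "\<And>x. x \<in> U \<Longrightarrow> f x = g x" "Ck_on k f U"
  shows "Ck_on k g U"
  using assms(2,3)
proof (induction k arbitrary: f g)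
  case 0
  then show ?case using continuous_on_eq by fastforce
next
  case (Suc k)
  have df: "f differentiable at x" if "x \<in> U" for x
    using Suc.prems(2) that assms(1) by (auto simp: differentiable_on_eq_differentiable_at)
  have "(g has_derivative frechet_derivative f (at x)) (at x)" if "x \<in> U" for x
    by (rule has_derivative_transform_within_open[of f _ _ _ U])
      (use df[OF that] that assms(1) Suc.prems(1) in \<open>auto simp: frechet_derivative_works[symmetric]\<close>)
  then have "g differentiable_on U"
    using assms(1) by (auto simp: differentiable_on_eq_differentiable_at differentiable_def)
  moreover have "Ck_on k (\<lambda>x. frechet_derivative g (at x) v) U" for v
  proof (rule Suc.IH)
    show "Ck_on k (\<lambda>x. frechet_derivative f (at x) v) U" using Suc.prems(2) by simp
    show "frechet_derivative f (at x) v = frechet_derivative g (at x) v" if "x \<in> U" for x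
      using frechet_derivative_transform_within_open[OF df[OF that] assms(1) that] Suc.prems(1) by simp
  qed
  ultimately show ?case by simp
qed

lemma Ck_on_SucI:
  assumes U: "open U" and f: "\<And>x. x \<in> U \<Longrightarrow> (f has_derivative f' x) (at x)"
    and f': "\<And>v. Ck_on k (\<lambda>x. f' x v) U"
  shows "Ck_on (Suc k) f U"
proof -
  have "f differentiable_on U"
    using f U by (auto simp: differentiable_on_eq_differentiable_at differentiable_def)
  moreover have "Ck_on k (\<lambda>x. frechet_derivative f (at x) v) U" for v
    by (rule Ck_on_cong[OF U _ f'[of v]]) (use frechet_derivative_at[OF f] in metis)
  ultimately show ?thesis by simp
qed

lemma Ck_on_SucD:
  assumes "open U" "Ck_on (Suc k) f U"
  shows "x \<in> U \<Longrightarrow> (f has_derivative frechet_derivative f (at x)) (at x)"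
    and "Ck_on k (\<lambda>x. frechet_derivative f (at x) v) U"
  using assms by (auto simp: differentiable_on_eq_differentiable_at frechet_derivative_works[symmetric])

text \<open>With an affine inner map, the derivative along \<open>v\<close> is the derivative of
  \<open>f\<close> along the constant vector \<open>A v\<close>, composed with the same map. The
  induction therefore closes without a product rule.\<close>

lemma Ck_on_compose_affine:
  assumes "bounded_linear A" "open U" "open V" "\<And>x. x \<in> V \<Longrightarrow> A x + c \<in> U" "Ck_on k f U"
  shows "Ck_on k (\<lambda>x. f (A x + c)) V"
  using assms(5)
proof (induction k arbitrary: f)
  case 0
  have "continuous_on V (\<lambda>x. A x + c)"
    by (intro continuous_intros linear_continuous_on assms)
  then show ?case using 0 assms(4) by (auto intro!: continuous_on_compose2[of U f])
next
  case (Suc k)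
  show ?case
  proof (rule Ck_on_SucI[OF assms(3)])
    fix x assume x: "x \<in> V"
    have "((\<lambda>x. A x + c) has_derivative A) (at x)"
      using assms(1) by (auto intro!: derivative_eq_intros bounded_linear_imp_has_derivative)
    from has_derivative_compose[OF this Ck_on_SucD(1)[OF assms(2) Suc.prems assms(4)[OF x]]]
    show "((\<lambda>x. f (A x + c)) has_derivative (\<lambda>v. frechet_derivative f (at (A x + c)) (A v))) (at x)" .
  next
    fix v show "Ck_on k (\<lambda>x. frechet_derivative f (at (A x + c)) (A v)) V"
      by (rule Suc.IH[OF Ck_on_SucD(2)[OF assms(2) Suc.prems]])
  qed
qed

lemma Ck_on_add:
  assumes "open U" "Ck_on k f U" "Ck_on k g U"
  shows "Ck_on k (\<lambda>x. f x + g x) U"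
  using assms(2,3)
proof (induction k arbitrary: f g)
  case 0
  then show ?case by (auto intro: continuous_intros)
next
  case (Suc k)
  show ?case
  proof (rule Ck_on_SucI[OF assms(1)])
    fix x assume x: "x \<in> U"
    show "((\<lambda>x. f x + g x) has_derivative
        (\<lambda>v. frechet_derivative f (at x) v + frechet_derivative g (at x) v)) (at x)"
      by (intro has_derivative_add Ck_on_SucD(1)[OF assms(1), of k] Suc.prems x)
  next
    fix v show "Ck_on k (\<lambda>x. frechet_derivative f (at x) v + frechet_derivative g (at x) v) U"
      by (intro Suc.IH Ck_on_SucD(2)[OF assms(1)] Suc.prems)
  qed
qed

lemma Ck_on_const: "Ck_on k (\<lambda>x. c) U"
  by (induction k arbitrary: c) (auto simp: differentiable_on_def)

lemma smooth_map_on_linear: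
  assumes "bounded_linear A" "open U"
  shows "smooth_map_on A U"
  unfolding smooth_map_on_def
proof
  fix k show "Ck_on k A U"
  proof (cases k)
    case 0
    then show ?thesis using assms by (simp add: linear_continuous_on)
  next
    case (Suc j)
    then show ?thesis
      using Ck_on_SucI[OF assms(2) bounded_linear_imp_has_derivative[OF assms(1)] Ck_on_const] by blast
  qed
qed

lemma smooth_map_on_add:
  "open U \<Longrightarrow> smooth_map_on f U \<Longrightarrow> smooth_map_on g U \<Longrightarrow> smooth_map_on (\<lambda>x. f x + g x) U"
  by (simp add: smooth_map_on_def Ck_on_add)

lemma smooth_map_on_compose_affine:
  assumes "bounded_linear A" "open U" "open V" "\<And>x. x \<in> V \<Longrightarrow> A x + c \<in> U" "smooth_map_on f U"
  shows "smooth_map_on (\<lambda>x. f (A x + c)) V"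
  using Ck_on_compose_affine[OF assms(1-4), of _ f] assms(5) unfolding smooth_map_on_def by blast

lemma smooth_map_on_has_derivative:
  "open U \<Longrightarrow> smooth_map_on f U \<Longrightarrow> x \<in> U \<Longrightarrow> (f has_derivative frechet_derivative f (at x)) (at x)"
  unfolding smooth_map_on_def using Ck_on_SucD(1) by blast

lemma smooth_map_on_frechet_derivative:
  "open U \<Longrightarrow> smooth_map_on f U \<Longrightarrow> smooth_map_on (\<lambda>x. frechet_derivative f (at x) v) U"
  unfolding smooth_map_on_def using Ck_on_SucD(2) by blast

lemma smooth_map_on_continuous: "smooth_map_on f U \<Longrightarrow> continuous_on U f"
  unfolding smooth_map_on_def using Ck_on.simps(1) by blast

text \<open>Taking the velocity as a directional derivative places it in the recursion of
  \<open>Ck_on\<close>, so that velocities of smooth curves can be iterated.\<close>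

definition curve_deriv :: "(real \<Rightarrow> real^3) \<Rightarrow> real \<Rightarrow> real^3" where
  "curve_deriv \<alpha> s = frechet_derivative \<alpha> (at s) 1"

lemma smooth_map_on_curve_deriv:
  "open I \<Longrightarrow> smooth_map_on \<alpha> I \<Longrightarrow> smooth_map_on (curve_deriv \<alpha>) I"
  unfolding curve_deriv_def[abs_def] by (rule smooth_map_on_frechet_derivative)

lemma curve_deriv_vector_derivative:
  assumes "open I" "smooth_map_on \<alpha> I" "s \<in> I"
  shows "(\<alpha> has_vector_derivative curve_deriv \<alpha> s) (at s)"
    and "vector_derivative \<alpha> (at s) = curve_deriv \<alpha> s"
proof -
  have d: "(\<alpha> has_derivative frechet_derivative \<alpha> (at s)) (at s)"
    using smooth_map_on_has_derivative[OF assms] .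
  have "frechet_derivative \<alpha> (at s) h = h *\<^sub>R curve_deriv \<alpha> s" for h
    using linear_scale[OF has_derivative_linear[OF d], of h 1] by (simp add: curve_deriv_def)
  then show *: "(\<alpha> has_vector_derivative curve_deriv \<alpha> s) (at s)"
    using d unfolding has_vector_derivative_def by (metis (no_types, lifting) ext)
  then show "vector_derivative \<alpha> (at s) = curve_deriv \<alpha> s" by (rule vector_derivative_at)
qed

lemma du_eq: "(X has_derivative f') (at p) \<Longrightarrow> du X p = f' (1, 0)"
  and dv_eq: "(X has_derivative f') (at p) \<Longrightarrow> dv X p = f' (0, 1)"
  by (simp_all add: du_def dv_def frechet_derivative_at[symmetric])

lemma du_dv_cong:
  assumes "(X has_derivative f') (at p)" "open U" "p \<in> U" "\<And>x. x \<in> U \<Longrightarrow> X x = Y x"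
  shows "du Y p = f' (1, 0)" "dv Y p = f' (0, 1)"
  using has_derivative_transform_within_open[OF assms] du_eq dv_eq by blast+

section \<open>Derivatives and curvature of translation patches\<close>

lemma translation_patch_derivatives:
  fixes \<alpha> \<beta> :: "real \<Rightarrow> real^3"
  assumes I: "open I" "smooth_map_on \<alpha> I" and J: "open J" "smooth_map_on \<beta> J"
  defines "\<Psi> \<equiv> \<lambda>(s, t). \<alpha> s + \<beta> t"
  assumes st: "s \<in> I" "t \<in> J"
  shows "du \<Psi> (s, t) = curve_deriv \<alpha> s" "dv \<Psi> (s, t) = curve_deriv \<beta> t"
    "du (du \<Psi>) (s, t) = curve_deriv (curve_deriv \<alpha>) s" "dv (du \<Psi>) (s, t) = 0"
    "dv (dv \<Psi>) (s, t) = curve_deriv (curve_deriv \<beta>) t"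
proof -
  have fstd: "((\<lambda>p. f (fst p)) has_derivative (\<lambda>h. fst h *\<^sub>R f')) (at (s, t))"
    if "(f has_vector_derivative f') (at s)" for f :: "real \<Rightarrow> real^3" and f' s t
    using has_derivative_compose[OF bounded_linear_imp_has_derivative[OF bounded_linear_fst], of f _ "(s, t)"] that
    by (simp add: has_vector_derivative_def)
  have sndd: "((\<lambda>p. f (snd p)) has_derivative (\<lambda>h. snd h *\<^sub>R f')) (at (s, t))"
    if "(f has_vector_derivative f') (at t)" for f :: "real \<Rightarrow> real^3" and f' s t
    using has_derivative_compose[OF bounded_linear_imp_has_derivative[OF bounded_linear_snd], of f _ "(s, t)"] that
    by (simp add: has_vector_derivative_def)
  have \<Psi>: "\<Psi> = (\<lambda>p. \<alpha> (fst p) + \<beta> (snd p))" by (auto simp: \<Psi>_def)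
  have d1: "du \<Psi> (s, t) = curve_deriv \<alpha> s" "dv \<Psi> (s, t) = curve_deriv \<beta> t"
    if st: "s \<in> I" "t \<in> J" for s t
  proof -
    have "(\<Psi> has_derivative (\<lambda>h. fst h *\<^sub>R curve_deriv \<alpha> s + snd h *\<^sub>R curve_deriv \<beta> t)) (at (s, t))"
      unfolding \<Psi> by (intro has_derivative_add fstd sndd curve_deriv_vector_derivative[OF I st(1)]
        curve_deriv_vector_derivative[OF J st(2)])
    from du_eq[OF this] dv_eq[OF this]
    show "du \<Psi> (s, t) = curve_deriv \<alpha> s" "dv \<Psi> (s, t) = curve_deriv \<beta> t" by simp_all
  qed
  then show "du \<Psi> (s, t) = curve_deriv \<alpha> s" "dv \<Psi> (s, t) = curve_deriv \<beta> t" using st by auto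
  have op: "open (I \<times> J)" "(s, t) \<in> I \<times> J" using I J st by (auto intro: open_Times)
  have a: "((\<lambda>p. curve_deriv \<alpha> (fst p)) has_derivative (\<lambda>h. fst h *\<^sub>R curve_deriv (curve_deriv \<alpha>) s)) (at (s, t))"
    by (intro fstd curve_deriv_vector_derivative[OF I(1) smooth_map_on_curve_deriv[OF I] st(1)])
  show "du (du \<Psi>) (s, t) = curve_deriv (curve_deriv \<alpha>) s" "dv (du \<Psi>) (s, t) = 0"
    using du_dv_cong[OF a op, of "du \<Psi>"] d1 by auto
  have b: "((\<lambda>p. curve_deriv \<beta> (snd p)) has_derivative (\<lambda>h. snd h *\<^sub>R curve_deriv (curve_deriv \<beta>) t)) (at (s, t))"
    by (intro sndd curve_deriv_vector_derivative[OF J(1) smooth_map_on_curve_deriv[OF J] st(2)])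
  show "dv (dv \<Psi>) (s, t) = curve_deriv (curve_deriv \<beta>) t"
    using du_dv_cong[OF b op, of "dv \<Psi>"] d1 by auto
qed

text \<open>The mixed derivative of \<open>\<alpha> s + \<beta> t\<close> vanishes, so
  \<open>M = 0\<close> and the curvature is \<open>L * N / (E*G - F^2)\<close>. Of the four factors
  \<open>norm (cross3 a b)\<close>, two come from the unit normals and two from
  \<open>E*G - F^2\<close>. The sign comes from exchanging \<open>a\<close> and \<open>a'\<close> in
  one triple product.\<close>

lemma translation_patch_curvature:
  fixes \<alpha> \<beta> :: "real \<Rightarrow> real^3"
  assumes I: "open I" "smooth_map_on \<alpha> I" and J: "open J" "smooth_map_on \<beta> J"
    and st: "s \<in> I" "t \<in> J"
    and reg: "cross3 (curve_deriv \<alpha> s) (curve_deriv \<beta> t) \<noteq> 0"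
    and K: "param_gaussian_curvature (\<lambda>(s, t). \<alpha> s + \<beta> t) (s, t) = K"
  shows "(cross3 (curve_deriv \<alpha> s) (curve_deriv (curve_deriv \<alpha>) s) \<bullet> curve_deriv \<beta> t)
     * (cross3 (curve_deriv \<beta> t) (curve_deriv (curve_deriv \<beta>) t) \<bullet> curve_deriv \<alpha> s)
     = - K * (norm (cross3 (curve_deriv \<alpha> s) (curve_deriv \<beta> t)))^4"
proof -
  define a a' b b' where ab: "a = curve_deriv \<alpha> s" "a' = curve_deriv (curve_deriv \<alpha>) s"
    "b = curve_deriv \<beta> t" "b' = curve_deriv (curve_deriv \<beta>) t"
  define m where "m = norm (cross3 a b)"
  have m: "m \<noteq> 0" using reg by (simp add: m_def ab)
  have m2: "(a \<bullet> a) * (b \<bullet> b) - (a \<bullet> b)^2 = m^2"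
    using norm_cross_dot[of a b] by (simp add: m_def power_mult_distrib power2_norm_eq_inner)
  have "K = ((a' \<bullet> cross3 a b) / m * ((b' \<bullet> cross3 a b) / m)) / m^2"
    using K unfolding param_gaussian_curvature_def Let_def unit_normal_def
      translation_patch_derivatives[OF I J st] ab[symmetric] m2
    by (simp add: m_def divide_inverse_commute)
  then have "K * m^4 = (a' \<bullet> cross3 a b) * (b' \<bullet> cross3 a b)"
    using m by (simp add: field_simps power2_eq_square power4_eq_xxxx)
  also have "\<dots> = - ((cross3 a a' \<bullet> b) * (cross3 b b' \<bullet> a))"
    by (simp add: cross3_simps)
  finally show ?thesis unfolding ab[symmetric] m_def[symmetric] by simp
qed

subsection \<open>Flat translation patches\<close>

text \<open>Up to a positive factor, the derivative of \<open>(a \<bullet> n) / norm a\<close> is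
  \<open>cross3 n a \<bullet> cross3 a' a\<close>, by Lagrange's identity. It vanishes under either
  alternative in \<open>dir\<close>, and the alternative may change from point to point.\<close>

lemma direction_constant:
  fixes a a' :: "real \<Rightarrow> real^3"
  assumes I: "is_interval I" "s \<in> I" "s0 \<in> I"
    and a: "\<And>s. s \<in> I \<Longrightarrow> (a has_vector_derivative a' s) (at s)"
    and nz: "\<And>s. s \<in> I \<Longrightarrow> a s \<noteq> 0"
    and dir: "\<And>s. s \<in> I \<Longrightarrow> cross3 (a s) (a' s) = 0 \<or> (a s \<bullet> n = 0 \<and> a' s \<bullet> n = 0)"
  shows "(a s \<bullet> n) * norm (a s0) = (a s0 \<bullet> n) * norm (a s)"
proof -
  define f where "f s = (a s \<bullet> n) / sqrt (a s \<bullet> a s)" for s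
  have "(f has_real_derivative 0) (at s)" if s: "s \<in> I" for s
  proof -
    have pos: "a s \<bullet> a s > 0" using nz[OF s] by simp
    have "cross3 n (a s) \<bullet> cross3 (a' s) (a s) = (a' s \<bullet> n) * (a s \<bullet> a s) - (a s \<bullet> n) * (a s \<bullet> a' s)"
      by (simp add: cross3_simps)
    moreover have "cross3 n (a s) \<bullet> cross3 (a' s) (a s) = 0 \<or> (a s \<bullet> n = 0 \<and> a' s \<bullet> n = 0)"
      using dir[OF s] cross_skew[of "a' s" "a s"] by auto
    ultimately have num: "(a' s \<bullet> n) * (a s \<bullet> a s) - (a s \<bullet> n) * (a s \<bullet> a' s) = 0" by auto
    have "((\<lambda>s. a s \<bullet> n) has_real_derivative a' s \<bullet> n) (at s)"
      using has_real_derivative_inner[OF a[OF s] has_vector_derivative_const[of n]] by simp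
    moreover have "((\<lambda>s. sqrt (a s \<bullet> a s)) has_real_derivative (a s \<bullet> a' s) / sqrt (a s \<bullet> a s)) (at s)"
      using DERIV_chain2[OF DERIV_real_sqrt[OF pos] has_real_derivative_inner[OF a[OF s] a[OF s]]]
      by (simp add: inner_commute field_simps)
    ultimately have "(f has_real_derivative ((a' s \<bullet> n) * sqrt (a s \<bullet> a s)
        - (a s \<bullet> n) * ((a s \<bullet> a' s) / sqrt (a s \<bullet> a s))) / (sqrt (a s \<bullet> a s) * sqrt (a s \<bullet> a s))) (at s)"
      unfolding f_def[abs_def] by (rule DERIV_divide) (use pos in simp)
    moreover have "(a' s \<bullet> n) * sqrt (a s \<bullet> a s) - (a s \<bullet> n) * ((a s \<bullet> a' s) / sqrt (a s \<bullet> a s)) = 0"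
      using num pos by (simp add: field_simps)
    ultimately show ?thesis by simp
  qed
  then have "\<exists>c. \<forall>s\<in>I. f s = c"
    using I(1) by (intro has_field_derivative_zero_constant)
      (auto simp: is_interval_convex_1 intro: has_field_derivative_at_within)
  then have "f s = f s0" using I by auto
  then show ?thesis using nz[OF I(2)] nz[OF I(3)]
    by (simp add: f_def field_simps norm_eq_sqrt_inner)
qed

lemma open_nonzero_set:
  fixes f :: "real \<Rightarrow> 'a::real_normed_vector"
  assumes "open I" "\<And>s. s \<in> I \<Longrightarrow> (f has_vector_derivative f' s) (at s)"
  shows "open {s \<in> I. f s \<noteq> 0}"
proof -
  have "continuous_on I f"
    using assms(2) by (intro continuous_at_imp_continuous_on) (blast intro: has_vector_derivative_continuous)
  from continuous_open_preimage[OF this assms(1), of "-{0}"] have "open (I \<inter> f -` (-{0}))"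
    by (simp add: open_Compl)
  moreover have "I \<inter> f -` (-{0}) = {s \<in> I. f s \<noteq> 0}" by auto
  ultimately show ?thesis by simp
qed

text \<open>An orthogonality valid on an open parameter set can be differentiated: a fixed vector
  orthogonal to \<open>b\<close> near \<open>t\<close> is orthogonal to \<open>b\<close> and
  \<open>b'\<close>, hence parallel to \<open>cross3 b b'\<close>. By continuity,
  \<open>flat\<close> provides such an orthogonality for one curve or the other.\<close>

lemma binormals_parallel:
  fixes a a' a'' b b' b'' :: "real \<Rightarrow> real^3"
  assumes I: "open I" "s \<in> I" and J: "open J" "t \<in> J"
    and a: "\<And>s. s \<in> I \<Longrightarrow> (a has_vector_derivative a' s) (at s)"
      "\<And>s. s \<in> I \<Longrightarrow> (a' has_vector_derivative a'' s) (at s)"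
    and b: "\<And>t. t \<in> J \<Longrightarrow> (b has_vector_derivative b' t) (at t)"
      "\<And>t. t \<in> J \<Longrightarrow> (b' has_vector_derivative b'' t) (at t)"
    and flat: "\<And>s t. s \<in> I \<Longrightarrow> t \<in> J \<Longrightarrow>
        cross3 (a s) (a' s) \<bullet> b t = 0 \<or> cross3 (b t) (b' t) \<bullet> a s = 0"
    and d: "cross3 (b t) (b' t) \<noteq> 0"
  shows "cross3 (cross3 (a s) (a' s)) (cross3 (b t) (b' t)) = 0"
proof -
  define c where "c = (\<lambda>s. cross3 (a s) (a' s))"
  define d where "d = (\<lambda>t. cross3 (b t) (b' t))"
  have ortho: "v \<bullet> f x = 0 \<and> v \<bullet> f' x = 0"
    if "open T" "x \<in> T" "\<And>y. y \<in> T \<Longrightarrow> v \<bullet> f y = 0" "(f has_vector_derivative f' x) (at x)"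
    for v :: "real^3" and f f' T and x :: real
  proof
    show "v \<bullet> f x = 0" using that by blast
    have "((\<lambda>y. v \<bullet> f y) has_real_derivative 0) (at x)"
      by (rule has_field_derivative_transform_within_open[of "\<lambda>_. 0" _ _ T]) (use that in auto)
    moreover have "((\<lambda>y. v \<bullet> f y) has_real_derivative v \<bullet> f' x) (at x)"
      using has_real_derivative_inner[OF has_vector_derivative_const[of v] that(4)] by simp
    ultimately show "v \<bullet> f' x = 0" using DERIV_unique by blast
  qed
  have par: "cross3 v (cross3 x y) = 0" if "v \<bullet> x = 0 \<and> v \<bullet> y = 0" for v x y :: "real^3"
  proof -
    have "cross3 v (cross3 x y) = (v \<bullet> y) *\<^sub>R x - (v \<bullet> x) *\<^sub>R y" by (simp add: cross3_simps forall_3)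
    then show ?thesis using that by simp
  qed
  have dd: "(d has_vector_derivative cross3 (b t) (b'' t)) (at t)" if "t \<in> J" for t
    using has_vector_derivative_cross3[OF b(1)[OF that] b(2)[OF that]] by (simp add: d_def)
  have dc: "(c has_vector_derivative cross3 (a s) (a'' s)) (at s)" if "s \<in> I" for s
    using has_vector_derivative_cross3[OF a(1)[OF that] a(2)[OF that]] by (simp add: c_def)
  define T where "T = {t \<in> J. d t \<noteq> 0}"
  have T: "open T" "t \<in> T" unfolding T_def using open_nonzero_set[OF J(1) dd] J(2) d by (auto simp: d_def)
  show ?thesis
  proof (cases "\<forall>t'\<in>T. c s \<bullet> b t' = 0")
    case True
    then show ?thesis
      using par[OF ortho[where f = b and f' = b', OF T _ b(1)[OF J(2)], of "c s"]] by (simp add: c_def)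
  next
    case False
    \<comment> \<open>This case is contradictory: near \<open>s\<close> the product
      \<open>c \<bullet> b t'\<close> stays nonzero, so \<open>flat\<close> makes \<open>a\<close>
      orthogonal to \<open>d t'\<close>. Then \<open>c s\<close> is a multiple of
      \<open>d t'\<close> and thus orthogonal to \<open>b t'\<close>.\<close>
    then obtain t' where t': "t' \<in> J" "d t' \<noteq> 0" "c s \<bullet> b t' \<noteq> 0" by (auto simp: T_def)
    define S where "S = {s \<in> I. c s \<bullet> b t' \<noteq> 0}"
    have "((\<lambda>s. c s \<bullet> b t') has_vector_derivative cross3 (a s) (a'' s) \<bullet> b t') (at s)" if "s \<in> I" for s
      using has_real_derivative_inner[OF dc[OF that] has_vector_derivative_const[of "b t'"]]
      by (simp add: has_real_derivative_iff_has_vector_derivative)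
    from open_nonzero_set[OF I(1) this] have S: "open S" "s \<in> S" using I(2) t'(3) by (auto simp: S_def)
    have "d t' \<bullet> a s' = 0" if "s' \<in> S" for s'
      using that flat[of s' t'] t'(1) by (auto simp: S_def c_def d_def)
    from par[OF ortho[where f = a and f' = a', OF S this a(1)[OF I(2)]]] have "cross3 (d t') (c s) = 0" by (simp add: c_def)
    moreover have "cross3 (d t') (cross3 (d t') (c s)) = (d t' \<bullet> c s) *\<^sub>R d t' - (d t' \<bullet> d t') *\<^sub>R c s"
      by (simp add: cross3_simps forall_3)
    ultimately have "(d t' \<bullet> d t') *\<^sub>R c s = (d t' \<bullet> c s) *\<^sub>R d t'" by simp
    then have "((d t' \<bullet> d t') *\<^sub>R c s) \<bullet> b t' = ((d t' \<bullet> c s) *\<^sub>R d t') \<bullet> b t'" by simp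
    moreover have "d t' \<bullet> b t' = 0" by (simp add: d_def dot_cross_self)
    ultimately have "c s \<bullet> b t' = 0" using t'(2) by simp
    then show ?thesis using t'(3) by simp
  qed
qed

text \<open>If neither curve is straight, pick a nonzero binormal of each; they are parallel to each
  other and to all other nonzero binormals. \<open>direction_constant\<close> carries orthogonality
  to this direction through the parameters where a binormal vanishes.\<close>

lemma flat_alternatives:
  fixes a a' a'' b b' b'' :: "real \<Rightarrow> real^3"
  assumes I: "open I" "is_interval I" and J: "open J" "is_interval J"
    and a: "\<And>s. s \<in> I \<Longrightarrow> (a has_vector_derivative a' s) (at s)"
      "\<And>s. s \<in> I \<Longrightarrow> (a' has_vector_derivative a'' s) (at s)" "\<And>s. s \<in> I \<Longrightarrow> a s \<noteq> 0"
    and b: "\<And>t. t \<in> J \<Longrightarrow> (b has_vector_derivative b' t) (at t)"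
      "\<And>t. t \<in> J \<Longrightarrow> (b' has_vector_derivative b'' t) (at t)" "\<And>t. t \<in> J \<Longrightarrow> b t \<noteq> 0"
    and flat: "\<And>s t. s \<in> I \<Longrightarrow> t \<in> J \<Longrightarrow>
        cross3 (a s) (a' s) \<bullet> b t = 0 \<or> cross3 (b t) (b' t) \<bullet> a s = 0"
  shows "(\<forall>s\<in>I. cross3 (a s) (a' s) = 0) \<or> (\<forall>t\<in>J. cross3 (b t) (b' t) = 0) \<or>
    (\<exists>n. n \<noteq> 0 \<and> (\<forall>s\<in>I. a s \<bullet> n = 0) \<and> (\<forall>t\<in>J. b t \<bullet> n = 0))"
proof (rule ccontr)
  assume neg: "\<not> ?thesis"
  then obtain s1 t1 where s1: "s1 \<in> I" "cross3 (a s1) (a' s1) \<noteq> 0"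
    and t1: "t1 \<in> J" "cross3 (b t1) (b' t1) \<noteq> 0" by blast
  define n where "n = cross3 (a s1) (a' s1)"
  define m where "m = cross3 (b t1) (b' t1)"
  have perp: "x \<bullet> v = 0 \<and> y \<bullet> v = 0" if "cross3 (cross3 x y) v = 0" "cross3 x y \<noteq> 0" for x y v :: "real^3"
  proof -
    let ?c = "cross3 x y"
    have "cross3 ?c (cross3 ?c v) = (?c \<bullet> v) *\<^sub>R ?c - (?c \<bullet> ?c) *\<^sub>R v" by (simp add: cross3_simps forall_3)
    then have v: "(?c \<bullet> ?c) *\<^sub>R v = (?c \<bullet> v) *\<^sub>R ?c" using that by simp
    have "(?c \<bullet> ?c) * (x \<bullet> v) = x \<bullet> ((?c \<bullet> ?c) *\<^sub>R v)" "(?c \<bullet> ?c) * (y \<bullet> v) = y \<bullet> ((?c \<bullet> ?c) *\<^sub>R v)"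
      by simp_all
    then have "(?c \<bullet> ?c) * (x \<bullet> v) = 0" "(?c \<bullet> ?c) * (y \<bullet> v) = 0"
      unfolding v by (simp_all add: dot_cross_self)
    then show ?thesis using that(2) by simp
  qed
  have bn: "cross3 (b t) (b' t) = 0 \<or> (b t \<bullet> n = 0 \<and> b' t \<bullet> n = 0)" if "t \<in> J" for t
  proof (cases "cross3 (b t) (b' t) = 0")
    case False
    from binormals_parallel[OF I(1) s1(1) J(1) that a(1,2) b(1,2) flat False]
    have "cross3 (cross3 (b t) (b' t)) n = 0"
      using cross_skew[of "cross3 (b t) (b' t)" n] by (simp add: n_def)
    from perp[OF this False] show ?thesis by simp
  qed simp
  have am: "cross3 (a s) (a' s) = 0 \<or> (a s \<bullet> m = 0 \<and> a' s \<bullet> m = 0)" if "s \<in> I" for s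
  proof (cases "cross3 (a s) (a' s) = 0")
    case False
    from perp[OF binormals_parallel[OF I(1) that J(1) t1(1) a(1,2) b(1,2) flat t1(2)] False]
    show ?thesis by (simp add: m_def)
  qed simp
  have nm: "cross3 n m = 0"
    using binormals_parallel[OF I(1) s1(1) J(1) t1(1) a(1,2) b(1,2) flat t1(2)] by (simp add: n_def m_def)
  have "a s \<bullet> m = 0" if "s \<in> I" for s
    using direction_constant[OF I(2) that s1(1) a(1) a(3) am] am[OF s1(1)] s1(2) a(3)[OF s1(1)] by auto
  moreover have "b t \<bullet> m = 0" if "t \<in> J" for t
  proof -
    have "b t \<bullet> n = 0"
      using direction_constant[OF J(2) that t1(1) b(1) b(3) bn] bn[OF t1(1)] t1(2) b(3)[OF t1(1)] by auto
    moreover have "cross3 n (cross3 n m) = (n \<bullet> m) *\<^sub>R n - (n \<bullet> n) *\<^sub>R m" by (simp add: cross3_simps forall_3)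
    then have "(n \<bullet> n) *\<^sub>R m = (n \<bullet> m) *\<^sub>R n" using nm by simp
    then have "b t \<bullet> ((n \<bullet> n) *\<^sub>R m) = b t \<bullet> ((n \<bullet> m) *\<^sub>R n)" by simp
    ultimately show ?thesis using s1(2) by (simp add: n_def)
  qed
  moreover have "m \<noteq> 0" using t1 by (simp add: m_def)
  ultimately show False using neg by blast
qed

section \<open>Straight segments in curves and planes\<close>

lemma open_segment_ray:
  fixes x w :: "'a::euclidean_space"
  assumes "l > 0" "w \<noteq> 0"
  shows "open_segment x (x + l *\<^sub>R w) = (\<lambda>\<tau>. x + \<tau> *\<^sub>R w) ` {0<..<l}"
proof -
  have "open_segment x (x + l *\<^sub>R w) = (\<lambda>u. x + (u * l) *\<^sub>R w) ` {0<..<1}"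
    using assms by (auto simp: open_segment_image_interval algebra_simps)
  also have "\<dots> = (\<lambda>\<tau>. x + \<tau> *\<^sub>R w) ` ((\<lambda>u. u * l) ` {0<..<1})" by (simp add: image_image)
  also have "(\<lambda>u. u * l) ` {0<..<1} = {0<..<l}"
  proof
    show "{0<..<l} \<subseteq> (\<lambda>u. u * l) ` {0<..<1}"
    proof
      fix \<tau> assume "\<tau> \<in> {0<..<l}"
      then show "\<tau> \<in> (\<lambda>u. u * l) ` {0<..<1}" using assms by (intro image_eqI[of _ _ "\<tau> / l"]) auto
    qed
  qed (use assms in auto)
  finally show ?thesis .
qed

text \<open>The tangent keeps its direction, so the curve is \<open>c + f s *\<^sub>R w\<close> with
  increasing \<open>f\<close>, and the intermediate value theorem fills a segment.\<close>

lemma straight_curve_segments: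
  fixes \<alpha> a a' :: "real \<Rightarrow> real^3"
  assumes I: "open I" "is_interval I" "s0 \<in> I"
    and \<alpha>: "\<And>s. s \<in> I \<Longrightarrow> (\<alpha> has_vector_derivative a s) (at s)"
    and a: "\<And>s. s \<in> I \<Longrightarrow> (a has_vector_derivative a' s) (at s)" "\<And>s. s \<in> I \<Longrightarrow> a s \<noteq> 0"
    and straight: "\<And>s. s \<in> I \<Longrightarrow> cross3 (a s) (a' s) = 0"
    and s: "s \<in> I"
  shows "\<exists>x l. l > 0 \<and> \<alpha> s \<in> open_segment x (x + l *\<^sub>R a s0) \<and> open_segment x (x + l *\<^sub>R a s0) \<subseteq> \<alpha> ` I"
proof -
  define w where "w = a s0"
  have w: "w \<noteq> 0" using a(2)[OF I(3)] by (simp add: w_def)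
  define \<rho> where "\<rho> s = norm (a s) / norm w" for s
  \<comment> \<open>\<open>direction_constant\<close> against every test vector \<open>n\<close>
    shows that the unit tangents at \<open>s\<close> and \<open>s0\<close> agree.\<close>
  have a\<rho>: "a s = \<rho> s *\<^sub>R w" if "s \<in> I" for s
  proof (rule vector_eq_rdot[THEN iffD1, rule_format])
    fix n
    show "a s \<bullet> n = (\<rho> s *\<^sub>R w) \<bullet> n"
      using direction_constant[OF I(2) that I(3) a, of n] straight w
      by (simp add: \<rho>_def w_def field_simps)
  qed
  define f where "f s = \<alpha> s \<bullet> w / (w \<bullet> w)" for s
  have df: "(f has_real_derivative \<rho> s) (at s)" if "s \<in> I" for s
    using DERIV_cdivide[OF has_real_derivative_inner[OF \<alpha>[OF that] has_vector_derivative_const[of w]], of "w \<bullet> w"] w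
    by (simp add: a\<rho>[OF that] f_def[abs_def])
  have "((\<lambda>s. \<alpha> s - f s *\<^sub>R w) has_vector_derivative 0) (at s within I)" if "s \<in> I" for s
  proof -
    have "((\<lambda>s. f s *\<^sub>R w) has_vector_derivative \<rho> s *\<^sub>R w) (at s)"
      using has_vector_derivative_scaleR[OF df[OF that] has_vector_derivative_const[of w]] by simp
    from has_vector_derivative_diff[OF \<alpha>[OF that] this] show ?thesis
      using a\<rho>[OF that] by (simp add: has_vector_derivative_at_within)
  qed
  then obtain c where c: "\<And>s. s \<in> I \<Longrightarrow> \<alpha> s - f s *\<^sub>R w = c"
    using has_vector_derivative_zero_constant[of I "\<lambda>s. \<alpha> s - f s *\<^sub>R w"] I(2) by (auto simp: is_interval_convex_1)
  have \<alpha>f: "\<alpha> s = c + f s *\<^sub>R w" if "s \<in> I" for s using c[OF that] by (simp add: algebra_simps)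
  \<comment> \<open>A closed ball, so that the endpoints \<open>s - e\<close> and
    \<open>s + e\<close> lie in \<open>I\<close>.\<close>
  obtain e where e: "e > 0" "cball s e \<subseteq> I" using I(1) s open_contains_cball by blast
  have sub: "{s - e..s + e} \<subseteq> I" using e(2) by (simp add: cball_eq_atLeastAtMost)
  have mono: "f x < f y" if "s - e \<le> x" "x < y" "y \<le> s + e" for x y
  proof (rule DERIV_pos_imp_increasing[OF that(2)])
    fix z assume "x \<le> z" "z \<le> y"
    then have "z \<in> I" using that sub by auto
    then show "\<exists>d. (f has_real_derivative d) (at z) \<and> d > 0"
      using df[of z] a(2)[of z] w by (intro exI[of _ "\<rho> z"]) (simp add: \<rho>_def)
  qed
  define l where "l = f (s + e) - f (s - e)"
  have l: "l > 0" using mono[of "s - e" "s + e"] e by (simp add: l_def)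
  define x where "x = \<alpha> (s - e)"
  have x: "x = c + f (s - e) *\<^sub>R w" unfolding x_def by (rule \<alpha>f) (use sub e in auto)
  have "\<alpha> s = x + (f s - f (s - e)) *\<^sub>R w" using \<alpha>f[OF s] x by (simp add: algebra_simps)
  moreover have "f s - f (s - e) \<in> {0<..<l}" using mono[of "s - e" s] mono[of s "s + e"] e by (simp add: l_def)
  ultimately have "\<alpha> s \<in> open_segment x (x + l *\<^sub>R w)" unfolding open_segment_ray[OF l w] by blast
  moreover have "open_segment x (x + l *\<^sub>R w) \<subseteq> \<alpha> ` I"
  proof
    fix q assume "q \<in> open_segment x (x + l *\<^sub>R w)"
    then obtain \<tau> where \<tau>: "0 < \<tau>" "\<tau> < l" "q = x + \<tau> *\<^sub>R w" unfolding open_segment_ray[OF l w] by auto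
    have "\<exists>r\<ge>s - e. r \<le> s + e \<and> f r = f (s - e) + \<tau>"
    proof (rule IVT)
      show "\<forall>r. s - e \<le> r \<and> r \<le> s + e \<longrightarrow> isCont f r" using df sub by (meson DERIV_isCont atLeastAtMost_iff subsetD)
    qed (use \<tau> e in \<open>auto simp: l_def\<close>)
    then obtain r where r: "r \<in> I" "f r = f (s - e) + \<tau>" using sub by auto
    then have "q = \<alpha> r" using \<alpha>f[OF r(1)] \<tau> x by (simp add: algebra_simps)
    then show "q \<in> \<alpha> ` I" using r by blast
  qed
  ultimately show ?thesis using l unfolding w_def by blast
qed

lemma openin_plane_segments:
  fixes W :: "(real^3) set"
  assumes W: "openin (top_of_set {x. n \<bullet> x = c}) W" and w: "n \<bullet> w = 0" "w \<noteq> 0" and q: "q \<in> W"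
  shows "\<exists>x l. l > 0 \<and> q \<in> open_segment x (x + l *\<^sub>R w) \<and> open_segment x (x + l *\<^sub>R w) \<subseteq> W"
proof -
  obtain e where e: "e > 0" "ball q e \<inter> {x. n \<bullet> x = c} \<subseteq> W"
    using W q unfolding openin_contains_ball by blast
  have qc: "n \<bullet> q = c" using W q openin_imp_subset by fastforce
  define \<tau> where "\<tau> = e / norm w"
  have \<tau>: "\<tau> > 0" using e w by (simp add: \<tau>_def)
  define x where "x = q - \<tau> *\<^sub>R w"
  have seg: "open_segment x (x + (2*\<tau>) *\<^sub>R w) = (\<lambda>r. x + r *\<^sub>R w) ` {0<..<2*\<tau>}"
    by (rule open_segment_ray) (use \<tau> w in auto)
  have "q \<in> open_segment x (x + (2*\<tau>) *\<^sub>R w)"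
    unfolding seg using \<tau> by (intro image_eqI[of _ _ \<tau>]) (auto simp: x_def)
  moreover have "open_segment x (x + (2*\<tau>) *\<^sub>R w) \<subseteq> W"
  proof
    fix y assume "y \<in> open_segment x (x + (2*\<tau>) *\<^sub>R w)"
    then obtain r where r: "0 < r" "r < 2*\<tau>" "y = x + r *\<^sub>R w" unfolding seg by auto
    have "y - q = (r - \<tau>) *\<^sub>R w" by (simp add: r x_def algebra_simps)
    then have "dist q y = \<bar>r - \<tau>\<bar> * norm w" by (metis dist_commute dist_norm norm_scaleR)
    also have "\<dots> < \<tau> * norm w" using r w by (intro mult_strict_right_mono) auto
    also have "\<dots> = e" using w by (simp add: \<tau>_def)
    finally have "y \<in> ball q e" by simp
    moreover have "n \<bullet> y = c" using qc w by (simp add: r x_def inner_diff_right inner_add_right)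
    ultimately show "y \<in> W" using e by auto
  qed
  ultimately show ?thesis using \<tau> by (intro exI[of _ x] exI[of _ "2*\<tau>"]) simp
qed

subsection \<open>Translation surfaces of constant curvature\<close>

lemma regular_parametrizationD:
  assumes "regular_parametrization S U X"
  shows "open U" "smooth_map_on X U" "openin (top_of_set S) (X ` U)" "\<exists>Y. homeomorphism U (X ` U) X Y"
    "\<And>p. p \<in> U \<Longrightarrow> cross3 (du X p) (dv X p) \<noteq> 0"
proof -
  note par = assms[unfolded regular_parametrization_def]
  show "open U" by (rule conjunct1[OF par])
  note par = conjunct2[OF par]
  show "smooth_map_on X U" by (rule conjunct1[OF par])
  note par = conjunct2[OF par]
  show "openin (top_of_set S) (X ` U)" by (rule conjunct1[OF par])
  note par = conjunct2[OF par]
  show "\<exists>Y. homeomorphism U (X ` U) X Y" by (rule conjunct1[OF par])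
  show "\<And>p. p \<in> U \<Longrightarrow> cross3 (du X p) (dv X p) \<noteq> 0" by (rule bspec[OF conjunct2[OF par]])
qed

lemma regular_parametrization_image:
  assumes "regular_parametrization S U X"
  shows "regular_surface (X ` U)"
proof -
  have "regular_parametrization (X ` U) U X"
    unfolding regular_parametrization_def
    by (intro conjI ballI regular_parametrizationD[OF assms] openin_subtopology_self)
  then show ?thesis unfolding regular_surface_def by (intro ballI exI conjI)
qed

lemma regular_parametrization_inj:
  assumes "regular_parametrization S U X"
  shows "inj_on X U"
proof -
  obtain Y where "homeomorphism U (X ` U) X Y"
    using regular_parametrizationD(4)[OF assms] by (elim exE)
  then have "\<And>x. x \<in> U \<Longrightarrow> Y (X x) = x" by (rule homeomorphism_apply1)
  then show ?thesis by (rule inj_on_inverseI)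
qed

text \<open>The translates of a straight generating curve are rulings. In the remaining case the
  patch lies in a plane and is open there by invariance of domain, so that any direction of the
  plane, such as \<open>a s0\<close>, can serve.\<close>

lemma flat_translation_patch_cylindrical:
  fixes \<alpha> \<beta> :: "real \<Rightarrow> real^3"
  defines "\<Psi> \<equiv> \<lambda>(s, t). \<alpha> s + \<beta> t"
  assumes I: "open I" "is_interval I" "smooth_map_on \<alpha> I"
    and J: "open J" "is_interval J" "smooth_map_on \<beta> J"
    and par: "regular_parametrization S (I \<times> J) \<Psi>" and ne: "I \<noteq> {}" "J \<noteq> {}"
    and reg: "\<And>s t. s \<in> I \<Longrightarrow> t \<in> J \<Longrightarrow> cross3 (curve_deriv \<alpha> s) (curve_deriv \<beta> t) \<noteq> 0"
    and flat: "\<And>s t. s \<in> I \<Longrightarrow> t \<in> J \<Longrightarrow>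
      cross3 (curve_deriv \<alpha> s) (curve_deriv (curve_deriv \<alpha>) s) \<bullet> curve_deriv \<beta> t = 0 \<or>
      cross3 (curve_deriv \<beta> t) (curve_deriv (curve_deriv \<beta>) t) \<bullet> curve_deriv \<alpha> s = 0"
  shows "cylindrical_surface (\<Psi> ` (I \<times> J))"
proof -
  define a a' a'' where a_def: "a = curve_deriv \<alpha>" "a' = curve_deriv a" "a'' = curve_deriv a'"
  define b b' b'' where b_def: "b = curve_deriv \<beta>" "b' = curve_deriv b" "b'' = curve_deriv b'"
  note sI = I(3) smooth_map_on_curve_deriv[OF I(1,3)]
    smooth_map_on_curve_deriv[OF I(1) smooth_map_on_curve_deriv[OF I(1,3)]]
  note sJ = J(3) smooth_map_on_curve_deriv[OF J(1,3)]
    smooth_map_on_curve_deriv[OF J(1) smooth_map_on_curve_deriv[OF J(1,3)]]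
  obtain s0 t0 where s0: "s0 \<in> I" and t0: "t0 \<in> J" using ne by blast
  note dI = curve_deriv_vector_derivative(1)[OF I(1)]
  note dJ = curve_deriv_vector_derivative(1)[OF J(1)]
  have a: "(\<alpha> has_vector_derivative a s) (at s)" "(a has_vector_derivative a' s) (at s)"
    "(a' has_vector_derivative a'' s) (at s)" "a s \<noteq> 0" if "s \<in> I" for s
    unfolding a_def using dI[OF sI(1) that] dI[OF sI(2) that] dI[OF sI(3) that] reg[OF that t0] by fastforce+
  have b: "(\<beta> has_vector_derivative b t) (at t)" "(b has_vector_derivative b' t) (at t)"
    "(b' has_vector_derivative b'' t) (at t)" "b t \<noteq> 0" if "t \<in> J" for t
    unfolding b_def using dJ[OF sJ(1) that] dJ[OF sJ(2) that] dJ[OF sJ(3) that] reg[OF s0 that] by fastforce+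
  have W: "regular_surface (\<Psi> ` (I \<times> J))" by (rule regular_parametrization_image[OF par])
  consider (\<alpha>) "\<forall>s\<in>I. cross3 (a s) (a' s) = 0" | (\<beta>) "\<forall>t\<in>J. cross3 (b t) (b' t) = 0"
    | (plane) n where "n \<noteq> 0" "\<forall>s\<in>I. a s \<bullet> n = 0" "\<forall>t\<in>J. b t \<bullet> n = 0"
    using flat_alternatives[OF I(1,2) J(1,2) a(2,3,4) b(2,3,4) flat[folded a_def b_def]] by metis
  then have "\<exists>w. w \<noteq> 0 \<and> (\<forall>q\<in>\<Psi> ` (I \<times> J). \<exists>x l. l > 0 \<and> q \<in> open_segment x (x + l *\<^sub>R w)
      \<and> open_segment x (x + l *\<^sub>R w) \<subseteq> \<Psi> ` (I \<times> J))"
  proof cases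
    case \<alpha>
    have "\<exists>x l. l > 0 \<and> q \<in> open_segment x (x + l *\<^sub>R a s0) \<and> open_segment x (x + l *\<^sub>R a s0) \<subseteq> \<Psi> ` (I \<times> J)"
      if "q \<in> \<Psi> ` (I \<times> J)" for q
    proof -
      obtain s t where st: "s \<in> I" "t \<in> J" "q = \<alpha> s + \<beta> t" using \<open>q \<in> \<Psi> ` (I \<times> J)\<close> by (auto simp: \<Psi>_def)
      have d: "((\<lambda>s. \<alpha> s + \<beta> t) has_vector_derivative a s) (at s)" if "s \<in> I" for s
        using has_vector_derivative_add[OF a(1)[OF that] has_vector_derivative_const] by simp
      have "(\<lambda>s. \<alpha> s + \<beta> t) ` I \<subseteq> \<Psi> ` (I \<times> J)" using st(1,2) by (auto simp: \<Psi>_def)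
      moreover obtain x l where "l > 0" "q \<in> open_segment x (x + l *\<^sub>R a s0)"
        "open_segment x (x + l *\<^sub>R a s0) \<subseteq> (\<lambda>s. \<alpha> s + \<beta> t) ` I"
        using straight_curve_segments[OF I(1,2) s0 d a(2,4) bspec[OF \<alpha>] st(1)] unfolding st(3) by blast
      ultimately show ?thesis by (meson order_trans)
    qed
    then show ?thesis using a(4)[OF s0] by blast
  next
    case \<beta>
    have "\<exists>x l. l > 0 \<and> q \<in> open_segment x (x + l *\<^sub>R b t0) \<and> open_segment x (x + l *\<^sub>R b t0) \<subseteq> \<Psi> ` (I \<times> J)"
      if "q \<in> \<Psi> ` (I \<times> J)" for q
    proof -
      obtain s t where st: "s \<in> I" "t \<in> J" "q = \<alpha> s + \<beta> t" using \<open>q \<in> \<Psi> ` (I \<times> J)\<close> by (auto simp: \<Psi>_def)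
      have d: "((\<lambda>t. \<alpha> s + \<beta> t) has_vector_derivative b t) (at t)" if "t \<in> J" for t
        using has_vector_derivative_add[OF has_vector_derivative_const b(1)[OF that]] by simp
      have "(\<lambda>t. \<alpha> s + \<beta> t) ` J \<subseteq> \<Psi> ` (I \<times> J)" using st(1,2) by (auto simp: \<Psi>_def)
      moreover obtain x l where "l > 0" "q \<in> open_segment x (x + l *\<^sub>R b t0)"
        "open_segment x (x + l *\<^sub>R b t0) \<subseteq> (\<lambda>t. \<alpha> s + \<beta> t) ` J"
        using straight_curve_segments[OF J(1,2) t0 d b(2,4) bspec[OF \<beta>] st(2)] unfolding st(3) by blast
      ultimately show ?thesis by (meson order_trans)
    qed
    then show ?thesis using b(4)[OF t0] by blast
  next
    case plane
    have const: "\<gamma> x \<bullet> n = \<gamma> y \<bullet> n" if "is_interval T" "x \<in> T" "y \<in> T"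
      and \<gamma>: "\<And>r. r \<in> T \<Longrightarrow> (\<gamma> has_vector_derivative g r) (at r)" and gn: "\<forall>r\<in>T. g r \<bullet> n = 0"
      for \<gamma> g :: "real \<Rightarrow> real^3" and T x y
    proof -
      have "((\<lambda>r. \<gamma> r \<bullet> n) has_field_derivative 0) (at r within T)" if "r \<in> T" for r
        using has_real_derivative_inner[OF \<gamma>[OF \<open>r \<in> T\<close>] has_vector_derivative_const[of n]] gn \<open>r \<in> T\<close>
        by (simp add: has_field_derivative_at_within)
      then have "\<exists>c. \<forall>r\<in>T. \<gamma> r \<bullet> n = c"
        using that(1) by (intro has_field_derivative_zero_constant) (auto simp: is_interval_convex_1)
      then show ?thesis using that(2,3) by auto
    qed
    define c where "c = n \<bullet> (\<alpha> s0 + \<beta> t0)"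
    let ?V = "{x. n \<bullet> x = c}"
    have "n \<bullet> (\<alpha> s + \<beta> t) = c" if "s \<in> I" "t \<in> J" for s t
    proof -
      have "\<alpha> s \<bullet> n = \<alpha> s0 \<bullet> n" by (rule const[OF I(2) that(1) s0 a(1) plane(2)])
      moreover have "\<beta> t \<bullet> n = \<beta> t0 \<bullet> n" by (rule const[OF J(2) that(2) t0 b(1) plane(3)])
      ultimately show ?thesis by (simp add: c_def inner_add_right inner_commute)
    qed
    then have "\<Psi> \<in> I \<times> J \<rightarrow> ?V" by (auto simp: \<Psi>_def)
    moreover have "continuous_on (I \<times> J) \<Psi>" "inj_on \<Psi> (I \<times> J)"
      using par regular_parametrization_inj[OF par]
      by (simp_all add: regular_parametrization_def smooth_map_on_continuous)
    moreover have "affine ?V" by (rule affine_hyperplane)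
    moreover have "aff_dim ?V \<le> aff_dim (UNIV :: (real \<times> real) set)" using plane(1) by simp
    ultimately have V: "openin (top_of_set ?V) (\<Psi> ` (I \<times> J))"
      using I(1) J(1) by (intro invariance_of_domain_affine_sets[of UNIV]) (auto simp: open_Times)
    have "n \<bullet> a s0 = 0" using plane(2) s0 by (simp add: inner_commute)
    from openin_plane_segments[OF V this a(4)[OF s0]]
    show ?thesis using a(4)[OF s0] by (intro exI[of _ "a s0"]) simp
  qed
  then show ?thesis using W unfolding cylindrical_surface_def by blast
qed

text \<open>On each translation patch the velocities satisfy the relation with
  \<open>\<kappa> = - k\<close>. Nonzero \<open>k\<close> is excluded by
  \<open>curvature_relation_contradiction\<close>; for \<open>k = 0\<close> one of the two triple
  products vanishes at each \<open>(s, t)\<close>.\<close>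

lemma translation_surface_constant_curvature_imp_cylindrical:
  assumes tr: "translation_surface S" and K: "constant_gaussian_curvature S"
  shows "locally_cylindrical S"
  unfolding locally_cylindrical_def
proof
  fix q assume q: "q \<in> S"
  obtain k where k: "\<And>q. q \<in> S \<Longrightarrow> has_gaussian_curvature S q k"
    using K by (auto simp: constant_gaussian_curvature_def)
  obtain I J \<alpha> \<beta> where I: "open I" "is_interval I" "smooth_map_on \<alpha> I"
    and J: "open J" "is_interval J" "smooth_map_on \<beta> J"
    and reg: "\<And>s t. s \<in> I \<Longrightarrow> t \<in> J \<Longrightarrow> cross3 (vector_derivative \<alpha> (at s)) (vector_derivative \<beta> (at t)) \<noteq> 0"
    and par: "regular_parametrization S (I \<times> J) (\<lambda>(s, t). \<alpha> s + \<beta> t)"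
    and q\<Psi>: "q \<in> (\<lambda>(s, t). \<alpha> s + \<beta> t) ` (I \<times> J)"
    using tr q unfolding translation_surface_def by blast
  let ?W = "(\<lambda>(s, t). \<alpha> s + \<beta> t) ` (I \<times> J)"
  have W: "openin (top_of_set S) ?W" using par by (simp add: regular_parametrization_def)
  have reg': "cross3 (curve_deriv \<alpha> s) (curve_deriv \<beta> t) \<noteq> 0" if "s \<in> I" "t \<in> J" for s t
    using reg[OF that] curve_deriv_vector_derivative(2)[OF I(1,3) that(1)]
      curve_deriv_vector_derivative(2)[OF J(1,3) that(2)] by simp
  have eq: "(cross3 (curve_deriv \<alpha> s) (curve_deriv (curve_deriv \<alpha>) s) \<bullet> curve_deriv \<beta> t)
     * (cross3 (curve_deriv \<beta> t) (curve_deriv (curve_deriv \<beta>) t) \<bullet> curve_deriv \<alpha> s)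
     = - k * (norm (cross3 (curve_deriv \<alpha> s) (curve_deriv \<beta> t)))^4" if st: "s \<in> I" "t \<in> J" for s t
  proof (rule translation_patch_curvature[OF I(1,3) J(1,3) st reg'[OF st]])
    have "\<alpha> s + \<beta> t \<in> S" using W st openin_imp_subset by fastforce
    from k[OF this] have "\<forall>U X. \<forall>p\<in>U. regular_parametrization S U X \<and> X p = \<alpha> s + \<beta> t \<longrightarrow>
        param_gaussian_curvature X p = k"
      unfolding has_gaussian_curvature_def by blast
    from this[rule_format, of "(s, t)" "I \<times> J" "\<lambda>(s, t). \<alpha> s + \<beta> t"]
    show "param_gaussian_curvature (\<lambda>(s, t). \<alpha> s + \<beta> t) (s, t) = k" using par st by simp
  qed
  have ne: "I \<noteq> {}" "J \<noteq> {}" using q\<Psi> by auto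
  have "k = 0"
  proof (rule ccontr)
    assume "k \<noteq> 0"
    note sI = smooth_map_on_curve_deriv[OF I(1)]
    note sJ = smooth_map_on_curve_deriv[OF J(1)]
    note dI = curve_deriv_vector_derivative(1)[OF I(1)]
    note dJ = curve_deriv_vector_derivative(1)[OF J(1)]
    show False
      by (rule curvature_relation_contradiction[OF I(1) ne(1) J(1,2) ne(2)
            dI[OF sI[OF I(3)]] dI[OF sI[OF sI[OF I(3)]]] dI[OF sI[OF sI[OF sI[OF I(3)]]]]
            dJ[OF sJ[OF J(3)]] eq _ reg']) (use \<open>k \<noteq> 0\<close> in auto)
  qed
  then have "cylindrical_surface ?W"
    using eq by (intro flat_translation_patch_cylindrical[OF I J par ne reg']) auto
  then show "\<exists>W. openin (top_of_set S) W \<and> q \<in> W \<and> cylindrical_surface W"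
    using W q\<Psi> by blast
qed

subsection \<open>Symmetry of mixed partial derivatives\<close>

text \<open>The mean value theorem is applied in \<open>s\<close> to the difference of
  \<open>f\<close> across the strip, then in \<open>t\<close> to \<open>fu\<close>.\<close>

lemma second_difference_mean_value:
  fixes f fu fuv :: "real \<Rightarrow> real \<Rightarrow> real"
  assumes h: "h > 0"
    and fu: "\<And>s t. s \<in> {s0..s0+h} \<Longrightarrow> t \<in> {t0..t0+h} \<Longrightarrow> ((\<lambda>s. f s t) has_real_derivative fu s t) (at s)"
    and fuv: "\<And>s t. s \<in> {s0..s0+h} \<Longrightarrow> t \<in> {t0..t0+h} \<Longrightarrow> ((\<lambda>t. fu s t) has_real_derivative fuv s t) (at t)"
  shows "\<exists>s\<in>{s0<..<s0+h}. \<exists>t\<in>{t0<..<t0+h}.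
      f (s0+h) (t0+h) - f (s0+h) t0 - f s0 (t0+h) + f s0 t0 = h * h * fuv s t"
proof -
  define g where "g s = f s (t0+h) - f s t0" for s
  have "\<exists>s>s0. s < s0 + h \<and> g (s0+h) - g s0 = (s0 + h - s0) * (fu s (t0+h) - fu s t0)"
    unfolding g_def[abs_def] by (rule MVT2) (use h in \<open>auto intro!: derivative_eq_intros fu\<close>)
  then obtain s where s: "s0 < s" "s < s0 + h" "g (s0+h) - g s0 = h * (fu s (t0+h) - fu s t0)" by auto
  have "\<exists>t>t0. t < t0 + h \<and> fu s (t0+h) - fu s t0 = (t0 + h - t0) * fuv s t"
    by (rule MVT2) (use h s in \<open>auto intro!: fuv\<close>)
  then obtain t where t: "t0 < t" "t < t0 + h" "fu s (t0+h) - fu s t0 = h * fuv s t" by auto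
  show ?thesis using s t by (intro bexI[of _ s] bexI[of _ t]) (auto simp: g_def)
qed

text \<open>The second difference over a small square is unchanged when the variables are exchanged,
  so it is \<open>h * h\<close> times a value of either mixed partial. By continuity both values are
  close to those at the corner.\<close>

lemma mixed_partials_symmetric_real:
  fixes f fu fv fuv fvu :: "real \<Rightarrow> real \<Rightarrow> real"
  assumes U: "open U" "(s0, t0) \<in> U"
    and fu: "\<And>s t. (s, t) \<in> U \<Longrightarrow> ((\<lambda>s. f s t) has_real_derivative fu s t) (at s)"
    and fuv: "\<And>s t. (s, t) \<in> U \<Longrightarrow> ((\<lambda>t. fu s t) has_real_derivative fuv s t) (at t)"
    and fv: "\<And>s t. (s, t) \<in> U \<Longrightarrow> ((\<lambda>t. f s t) has_real_derivative fv s t) (at t)"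
    and fvu: "\<And>s t. (s, t) \<in> U \<Longrightarrow> ((\<lambda>s. fv s t) has_real_derivative fvu s t) (at s)"
    and cont: "continuous_on U (\<lambda>(s, t). fuv s t)" "continuous_on U (\<lambda>(s, t). fvu s t)"
  shows "fuv s0 t0 = fvu s0 t0"
proof (rule ccontr)
  assume "fuv s0 t0 \<noteq> fvu s0 t0"
  define e where "e = \<bar>fuv s0 t0 - fvu s0 t0\<bar> / 2"
  have e: "e > 0" using \<open>fuv s0 t0 \<noteq> fvu s0 t0\<close> by (simp add: e_def)
  obtain d1 where d1: "d1 > 0" "ball (s0, t0) d1 \<subseteq> U" using U open_contains_ball by blast
  obtain d2 where d2: "d2 > 0" "\<And>s t. (s, t) \<in> U \<Longrightarrow> dist (s, t) (s0, t0) < d2 \<Longrightarrow> \<bar>fuv s t - fuv s0 t0\<bar> < e"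
    using cont(1)[unfolded continuous_on_iff, rule_format, OF U(2) e] by (fastforce simp: dist_real_def)
  obtain d3 where d3: "d3 > 0" "\<And>s t. (s, t) \<in> U \<Longrightarrow> dist (s, t) (s0, t0) < d3 \<Longrightarrow> \<bar>fvu s t - fvu s0 t0\<bar> < e"
    using cont(2)[unfolded continuous_on_iff, rule_format, OF U(2) e] by (fastforce simp: dist_real_def)
  define d where "d = min d1 (min d2 d3)"
  have d: "d > 0" "d \<le> d1" "d \<le> d2" "d \<le> d3" using d1 d2 d3 by (auto simp: d_def)
  \<comment> \<open>Points of the square of side \<open>h\<close> are within
    \<open>2 * h < d\<close> of the corner.\<close>
  define h where "h = d / 3"
  have h: "h > 0" using d by (simp add: h_def)
  have near: "dist (s, t) (s0, t0) < d" if "s \<in> {s0..s0+h}" "t \<in> {t0..t0+h}" for s t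
  proof -
    have "dist (s, t) (s0, t0) \<le> \<bar>s - s0\<bar> + \<bar>t - t0\<bar>"
      unfolding dist_Pair_Pair dist_real_def by (rule sqrt_sum_squares_le_sum_abs[THEN order_trans]) simp
    also have "\<dots> < d" using that d(1) by (auto simp: h_def)
    finally show ?thesis .
  qed
  have inU: "(s, t) \<in> U" if "s \<in> {s0..s0+h}" "t \<in> {t0..t0+h}" for s t
    using near[OF that] d(2) d1(2) by (auto simp: dist_commute)
  obtain s t where st: "s \<in> {s0<..<s0+h}" "t \<in> {t0<..<t0+h}"
      "f (s0+h) (t0+h) - f (s0+h) t0 - f s0 (t0+h) + f s0 t0 = h * h * fuv s t"
    using second_difference_mean_value[of h s0 t0 f fu fuv, OF h fu fuv] inU by blast
  obtain t' s' where st': "t' \<in> {t0<..<t0+h}" "s' \<in> {s0<..<s0+h}"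
      "f (s0+h) (t0+h) - f s0 (t0+h) - f (s0+h) t0 + f s0 t0 = h * h * fvu s' t'"
    using second_difference_mean_value[of h t0 s0 "\<lambda>t s. f s t" "\<lambda>t s. fv s t" "\<lambda>t s. fvu s t", OF h fv fvu] inU by blast
  have "fuv s t = fvu s' t'" using st(3) st'(3) h by (auto simp: algebra_simps)
  moreover have "\<bar>fuv s t - fuv s0 t0\<bar> < e" using near[of s t] st d inU by (intro d2) auto
  moreover have "\<bar>fvu s' t' - fvu s0 t0\<bar> < e" using near[of s' t'] st' d inU by (intro d3) auto
  ultimately have "\<bar>fuv s0 t0 - fvu s0 t0\<bar> < 2 * e" by linarith
  then show False by (simp add: e_def)
qed

lemma smooth_map_on_du: "open U \<Longrightarrow> smooth_map_on X U \<Longrightarrow> smooth_map_on (du X) U"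
  and smooth_map_on_dv: "open U \<Longrightarrow> smooth_map_on X U \<Longrightarrow> smooth_map_on (dv X) U"
  unfolding du_def[abs_def] dv_def[abs_def] by (simp_all add: smooth_map_on_frechet_derivative)

lemma smooth_map_on_has_derivative_du_dv:
  assumes "open U" "smooth_map_on X U" "p \<in> U"
  shows "(X has_derivative (\<lambda>h. fst h *\<^sub>R du X p + snd h *\<^sub>R dv X p)) (at p)"
proof -
  have d: "(X has_derivative frechet_derivative X (at p)) (at p)"
    by (rule smooth_map_on_has_derivative[OF assms])
  have "frechet_derivative X (at p) h = fst h *\<^sub>R du X p + snd h *\<^sub>R dv X p" for h
  proof -
    have "h = fst h *\<^sub>R (1, 0) + snd h *\<^sub>R (0, 1)" by (cases h) simp
    then show ?thesis unfolding du_def dv_def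
      using linear_add[OF has_derivative_linear[OF d]] linear_scale[OF has_derivative_linear[OF d]] by metis
  qed
  then show ?thesis using d by (metis (no_types, lifting) ext)
qed

lemma partial_vector_derivatives:
  assumes "open U" "smooth_map_on X U" "(s, t) \<in> U"
  shows "((\<lambda>s. X (s, t)) has_vector_derivative du X (s, t)) (at s)"
    and "((\<lambda>t. X (s, t)) has_vector_derivative dv X (s, t)) (at t)"
proof -
  note d = smooth_map_on_has_derivative_du_dv[OF assms]
  have "((\<lambda>s. (s, t)) has_derivative (\<lambda>h. (h, 0))) (at s)"
    by (auto intro!: derivative_eq_intros)
  from has_derivative_compose[OF this d]
  show "((\<lambda>s. X (s, t)) has_vector_derivative du X (s, t)) (at s)"
    by (simp add: has_vector_derivative_def)
  have "((\<lambda>t. (s, t)) has_derivative (\<lambda>h. (0, h))) (at t)"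
    by (auto intro!: derivative_eq_intros)
  from has_derivative_compose[OF this d]
  show "((\<lambda>t. X (s, t)) has_vector_derivative dv X (s, t)) (at t)"
    by (simp add: has_vector_derivative_def)
qed

lemma mixed_partials_symmetric:
  assumes U: "open U" "smooth_map_on X U" "p \<in> U"
  shows "du (dv X) p = dv (du X) p"
proof (rule vector_eq_rdot[THEN iffD1, rule_format])
  fix m :: "real^3"
  obtain s0 t0 where p: "p = (s0, t0)" by (cases p)
  note su = smooth_map_on_du[OF U(1,2)] and sv = smooth_map_on_dv[OF U(1,2)]
  have inner: "((\<lambda>r. f r \<bullet> m) has_real_derivative f' \<bullet> m) (at r)"
    if "(f has_vector_derivative f') (at r)" for f :: "real \<Rightarrow> real^3" and f' r
    using has_real_derivative_inner[OF that has_vector_derivative_const[of m]] by simp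
  have cont: "continuous_on U (\<lambda>x. g x \<bullet> m)" if "smooth_map_on g U" for g
    by (intro continuous_intros smooth_map_on_continuous that)
  have "dv (du X) (s0, t0) \<bullet> m = du (dv X) (s0, t0) \<bullet> m"
    by (rule mixed_partials_symmetric_real[of U s0 t0 "\<lambda>s t. X (s, t) \<bullet> m" "\<lambda>s t. du X (s, t) \<bullet> m"
          "\<lambda>s t. dv (du X) (s, t) \<bullet> m" "\<lambda>s t. dv X (s, t) \<bullet> m" "\<lambda>s t. du (dv X) (s, t) \<bullet> m"])
      (use U p in \<open>auto intro!: inner cont partial_vector_derivatives[OF U(1)] su sv
        smooth_map_on_du smooth_map_on_dv\<close>)
  then show "du (dv X) p \<bullet> m = dv (du X) p \<bullet> m" by (simp add: p)
qed

subsection \<open>Curvature of ruled patches\<close>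

lemma regular_parametrization_openin:
  assumes "regular_parametrization S U X" "open V" "V \<subseteq> U"
  shows "openin (top_of_set S) (X ` V)"
proof -
  note par = regular_parametrizationD[OF assms(1)]
  obtain Y where "homeomorphism U (X ` U) X Y" using par(4) by (elim exE)
  then have "openin (top_of_set (X ` U)) (X ` V)"
    by (rule homeomorphism_imp_open_map) (rule open_subset[OF assms(3,2)])
  then show ?thesis using par(3) openin_trans by blast
qed

lemma regular_parametrization_vimage_open:
  assumes "regular_parametrization S U X" "openin (top_of_set S) W"
  shows "open {p \<in> U. X p \<in> W}"
proof -
  note par = regular_parametrizationD[OF assms(1)]
  obtain O' where O': "open O'" "W = S \<inter> O'" using assms(2) by (auto simp: openin_open)
  have "X ` U \<subseteq> S" using par(3) openin_imp_subset by blast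
  then have "{p \<in> U. X p \<in> W} = U \<inter> X -` O'" using O'(2) by blast
  then show ?thesis
    using continuous_open_preimage[OF smooth_map_on_continuous[OF par(2)] par(1) O'(1)] by simp
qed

text \<open>The inverse \<open>Y\<close> is only known to be continuous, so the line is not pulled
  back to a differentiable curve. Instead, injectivity of the derivative \<open>L\<close> bounds the
  parameter displacement by a multiple of \<open>\<tau>\<close>. Since \<open>N\<close> is
  orthogonal to the range of \<open>L\<close>, the first-order expansion of \<open>X\<close> then
  makes \<open>\<tau> * (w \<bullet> N)\<close> of smaller order than \<open>\<tau>\<close>.\<close>

lemma line_in_surface_tangent:
  assumes par: "regular_parametrization S U X" and p: "p \<in> U"
    and line: "\<eta> > 0" "\<And>\<tau>. \<bar>\<tau>\<bar> < \<eta> \<Longrightarrow> X p + \<tau> *\<^sub>R w \<in> S"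
  shows "cross3 (du X p) (dv X p) \<bullet> w = 0"
proof -
  note D = regular_parametrizationD[OF par]
  define N where "N = cross3 (du X p) (dv X p)"
  have N: "N \<noteq> 0" using D(5)[OF p] by (simp add: N_def)
  define L where "L = (\<lambda>h::real \<times> real. fst h *\<^sub>R du X p + snd h *\<^sub>R dv X p)"
  have dX: "(X has_derivative L) (at p)"
    unfolding L_def by (rule smooth_map_on_has_derivative_du_dv[OF D(1,2) p])
  have LN: "N \<bullet> L h = 0" for h by (simp add: L_def N_def inner_add_right dot_cross_self)
  have lin: "linear L" using dX by (rule has_derivative_linear)
  have "inj L"
  proof (rule linear_injective_0[OF lin, THEN iffD2, rule_format])
    fix h assume "L h = 0"
    then have "cross3 (L h) (dv X p) = 0" "cross3 (du X p) (L h) = 0" by simp_all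
    then have "fst h *\<^sub>R N = 0" "snd h *\<^sub>R N = 0"
      by (simp_all add: L_def N_def cross_add_left cross_add_right cross_mult_left cross_mult_right)
    then show "h = 0" using N by (simp add: prod_eq_iff)
  qed
  then obtain B where B: "B > 0" "\<And>h. B * norm h \<le> norm (L h)"
    using linear_inj_bounded_below_pos[OF lin] by blast
  obtain Y where Y: "homeomorphism U (X ` U) X Y" using D(4) by (elim exE)
  obtain O' where O': "open O'" "X ` U = S \<inter> O'" using D(3) by (auto simp: openin_open)
  have bound: "\<bar>w \<bullet> N\<bar> \<le> 2 * \<epsilon> * norm N * norm w / B" if \<epsilon>: "\<epsilon> > 0" "\<epsilon> \<le> B / 2" for \<epsilon>
  proof -
    obtain d where d: "d > 0" "\<And>y. norm (y - p) < d \<Longrightarrow> norm (X y - X p - L (y - p)) \<le> \<epsilon> * norm (y - p)"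
      using dX[unfolded has_derivative_at_alt] \<epsilon>(1) by blast
    have "continuous_on (X ` U) Y" using Y by (simp add: homeomorphism_def)
    moreover have "X p \<in> X ` U" using p by simp
    ultimately obtain d2 where d2: "d2 > 0" "\<And>x. x \<in> X ` U \<Longrightarrow> dist x (X p) < d2 \<Longrightarrow> dist (Y x) (Y (X p)) < d"
      unfolding continuous_on_iff using d(1) by blast
    obtain d3 where d3: "d3 > 0" "ball (X p) d3 \<subseteq> O'"
      using O' \<open>X p \<in> X ` U\<close> open_contains_ball by blast
    \<comment> \<open>With this choice \<open>X p + \<tau> *\<^sub>R w\<close> lies on
      \<open>S\<close>, inside the open set \<open>O'\<close> that cuts out the patch, and so near
      \<open>X p\<close> that its parameter is within \<open>d\<close> of \<open>p\<close>.\<close>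
    define \<tau> where "\<tau> = min (\<eta> / 2) (min d2 d3 / (2 * (norm w + 1)))"
    have nw: "norm w + 1 > 0" by (simp add: add_nonneg_pos)
    have \<tau>: "\<tau> > 0" "\<bar>\<tau>\<bar> < \<eta>" using line(1) d2(1) d3(1) nw by (auto simp: \<tau>_def)
    have "\<tau> * norm w < min d2 d3"
    proof -
      have "\<tau> * norm w \<le> \<tau> * (norm w + 1)" using \<tau> by simp
      also have "\<dots> \<le> min d2 d3 / (2 * (norm w + 1)) * (norm w + 1)"
        using nw by (intro mult_right_mono) (auto simp: \<tau>_def)
      also have "\<dots> = min d2 d3 / 2" using nw by (simp add: field_simps)
      also have "\<dots> < min d2 d3"
      proof -
        have "min d2 d3 > 0" using d2(1) d3(1) by simp
        then show ?thesis by linarith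
      qed
      finally show ?thesis .
    qed
    then have near: "dist (X p + \<tau> *\<^sub>R w) (X p) < d2" "dist (X p + \<tau> *\<^sub>R w) (X p) < d3"
      using \<tau>(1) by (simp_all add: dist_norm)
    then have "X p + \<tau> *\<^sub>R w \<in> X ` U"
      using O'(2) line(2)[OF \<tau>(2)] d3(2) by (auto simp: dist_commute)
    then obtain y where y: "y \<in> U" "X y = X p + \<tau> *\<^sub>R w" by force
    have "Y (X y) = y" "Y (X p) = p" using homeomorphism_apply1[OF Y y(1)] homeomorphism_apply1[OF Y p] by simp_all
    moreover have "X y \<in> X ` U" using y(1) by simp
    ultimately have "norm (y - p) < d" using d2(2)[of "X y"] near(1) y(2) by (simp add: dist_norm)
    from d(2)[OF this] have r: "norm (\<tau> *\<^sub>R w - L (y - p)) \<le> \<epsilon> * norm (y - p)" by (simp add: y(2))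
    have "B * norm (y - p) \<le> norm (L (y - p))" by (rule B(2))
    also have "\<dots> \<le> norm (\<tau> *\<^sub>R w) + norm (\<tau> *\<^sub>R w - L (y - p))"
      by (metis add.commute norm_minus_commute norm_triangle_sub)
    \<comment> \<open>As \<open>\<epsilon> \<le> B / 2\<close>, half of the left side absorbs the
      error term.\<close>
    also have "\<dots> \<le> \<tau> * norm w + B / 2 * norm (y - p)"
      using r \<epsilon>(2) \<tau>(1) mult_right_mono[OF \<epsilon>(2), of "norm (y - p)"] by simp
    finally have yp: "norm (y - p) \<le> 2 * \<tau> * norm w / B" using B(1) by (simp add: field_simps)
    have "\<tau> * \<bar>w \<bullet> N\<bar> = \<bar>(\<tau> *\<^sub>R w - L (y - p)) \<bullet> N\<bar>"
      unfolding inner_diff_left inner_commute[of "L (y - p)"] LN using \<tau>(1) by (simp add: abs_mult)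
    also have "\<dots> \<le> norm (\<tau> *\<^sub>R w - L (y - p)) * norm N" by (rule Cauchy_Schwarz_ineq2)
    also have "\<dots> \<le> \<epsilon> * norm (y - p) * norm N" using r by (intro mult_right_mono) auto
    also have "\<dots> \<le> \<epsilon> * (2 * \<tau> * norm w / B) * norm N"
      using yp \<epsilon>(1) by (intro mult_right_mono mult_left_mono) auto
    also have "\<dots> = \<tau> * (2 * \<epsilon> * norm N * norm w / B)" by simp
    finally show ?thesis using \<tau>(1) by (simp only: mult_le_cancel_left_pos)
  qed
  have "w \<bullet> N = 0"
  proof (rule ccontr)
    assume neq: "w \<bullet> N \<noteq> 0"
    then have w: "norm w > 0" by auto
    define c where "c = 2 * norm N * norm w / B"
    have c: "c > 0" using w N B(1) by (simp add: c_def)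
    \<comment> \<open>Chosen so that \<open>bound\<close> gives at most half of
      \<open>\<bar>w \<bullet> N\<bar>\<close>.\<close>
    define \<epsilon> where "\<epsilon> = min (B / 2) (\<bar>w \<bullet> N\<bar> / (2 * c))"
    have "\<epsilon> > 0" "\<epsilon> \<le> B / 2" using B(1) c neq by (auto simp: \<epsilon>_def)
    from bound[OF this] have "\<bar>w \<bullet> N\<bar> \<le> \<epsilon> * c" by (simp add: c_def mult_ac)
    also have "\<dots> \<le> \<bar>w \<bullet> N\<bar> / (2 * c) * c" using c by (intro mult_right_mono) (auto simp: \<epsilon>_def)
    also have "\<dots> = \<bar>w \<bullet> N\<bar> / 2" using c by simp
    finally show False using neq by simp
  qed
  then show ?thesis by (simp add: N_def inner_commute)
qed

text \<open>The radius \<open>\<eta>\<close> depends on \<open>q\<close>: it is the distance, in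
  units of \<open>w\<close>, to the nearer end of the ruling segment.\<close>

lemma cylindrical_surface_rulings:
  assumes "cylindrical_surface W"
  obtains w where "w \<noteq> 0" "\<And>q. q \<in> W \<Longrightarrow> \<exists>\<eta>>0. \<forall>\<tau>. \<bar>\<tau>\<bar> < \<eta> \<longrightarrow> q + \<tau> *\<^sub>R w \<in> W"
proof -
  obtain w where w: "w \<noteq> 0" and seg: "\<And>q. q \<in> W \<Longrightarrow>
      \<exists>a l. l > 0 \<and> q \<in> open_segment a (a + l *\<^sub>R w) \<and> open_segment a (a + l *\<^sub>R w) \<subseteq> W"
    using assms by (auto simp: cylindrical_surface_def)
  have "\<exists>\<eta>>0. \<forall>\<tau>. \<bar>\<tau>\<bar> < \<eta> \<longrightarrow> q + \<tau> *\<^sub>R w \<in> W" if "q \<in> W" for q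
  proof -
    obtain a l where l: "l > 0" "q \<in> open_segment a (a + l *\<^sub>R w)" "open_segment a (a + l *\<^sub>R w) \<subseteq> W"
      using seg[OF \<open>q \<in> W\<close>] by blast
    obtain r where r: "0 < r" "r < l" "q = a + r *\<^sub>R w"
      using l(2) unfolding open_segment_ray[OF l(1) w] by auto
    have "q + \<tau> *\<^sub>R w \<in> W" if "\<bar>\<tau>\<bar> < min r (l - r)" for \<tau>
    proof -
      have "a + (r + \<tau>) *\<^sub>R w \<in> open_segment a (a + l *\<^sub>R w)"
        unfolding open_segment_ray[OF l(1) w] using that r by (intro imageI) auto
      then show ?thesis using l(3) r(3) by (auto simp: algebra_simps)
    qed
    then show ?thesis using r by (intro exI[of _ "min r (l - r)"]) auto
  qed
  then show ?thesis using that w by blast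
qed

text \<open>Cramer's rule for the Gram matrix of \<open>x\<close>, \<open>y\<close>. It follows from
  \<open>|N|^2 w = - N \<times> (N \<times> w)\<close>, valid for \<open>w\<close> orthogonal to
  \<open>N\<close>, and the triple product formula.\<close>

lemma cross3_frame_expansion:
  fixes x y w :: "real^3"
  assumes "cross3 x y \<bullet> w = 0"
  shows "(cross3 x y \<bullet> cross3 x y) *\<^sub>R w
    = ((w \<bullet> x) * (y \<bullet> y) - (w \<bullet> y) * (x \<bullet> y)) *\<^sub>R x + ((w \<bullet> y) * (x \<bullet> x) - (w \<bullet> x) * (x \<bullet> y)) *\<^sub>R y"
proof -
  define N where "N = cross3 x y"
  have tr: "cross3 u (cross3 v z) = (u \<bullet> z) *\<^sub>R v - (u \<bullet> v) *\<^sub>R z" for u v z :: "real^3"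
    by (simp add: cross3_simps forall_3)
  have 1: "cross3 N x = (x \<bullet> x) *\<^sub>R y - (x \<bullet> y) *\<^sub>R x" and 2: "cross3 N y = (x \<bullet> y) *\<^sub>R y - (y \<bullet> y) *\<^sub>R x"
    using tr[of x x y] tr[of y x y] cross_skew[of N x] cross_skew[of N y] by (simp_all add: N_def inner_commute)
  have "(N \<bullet> N) *\<^sub>R w = - cross3 N (cross3 N w)" using assms by (simp add: tr N_def)
  also have "\<dots> = cross3 N (cross3 w N)" by (metis cross_minus_right cross_skew)
  also have "\<dots> = (w \<bullet> y) *\<^sub>R cross3 N x - (w \<bullet> x) *\<^sub>R cross3 N y"
    unfolding N_def[symmetric] using tr[of w x y]
    by (simp add: N_def bounded_bilinear.diff_right[OF bounded_bilinear_cross3] cross_mult_right)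
  finally have "(N \<bullet> N) *\<^sub>R w = (w \<bullet> y) *\<^sub>R cross3 N x - (w \<bullet> x) *\<^sub>R cross3 N y" .
  then show ?thesis unfolding 1 2 by (simp add: N_def[symmetric] algebra_simps)
qed

text \<open>Differentiating \<open>N \<bullet> w = 0\<close> makes both partials of \<open>N\<close>
  orthogonal to \<open>w\<close>. Hence the coordinates \<open>(a, b)\<close> of \<open>w\<close>,
  up to scale, form a nonzero kernel vector of the second fundamental form, whose determinant must
  vanish.\<close>

lemma ruled_imp_zero_curvature:
  assumes par: "regular_parametrization S U X" and p: "p \<in> V" and V: "open V" "V \<subseteq> U"
    and w: "w \<noteq> 0" and tan: "\<And>p. p \<in> V \<Longrightarrow> cross3 (du X p) (dv X p) \<bullet> w = 0"
  shows "param_gaussian_curvature X p = 0"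
proof -
  note D = regular_parametrizationD[OF par]
  have pU: "p \<in> U" using p V by blast
  define x y where xy: "x = du X p" "y = dv X p"
  define xx xy' yy where d2: "xx = du (du X) p" "xy' = dv (du X) p" "yy = dv (dv X) p"
  define N where "N = cross3 x y"
  have N: "N \<noteq> 0" using D(5)[OF pU] by (simp add: N_def xy)
  obtain s t where st: "p = (s, t)" by (cases p)
  note pd = partial_vector_derivatives[OF D(1) smooth_map_on_du[OF D(1,2)] pU[unfolded st]]
    partial_vector_derivatives[OF D(1) smooth_map_on_dv[OF D(1,2)] pU[unfolded st]]
  note sym = mixed_partials_symmetric[OF D(1,2) pU]
  have zero: "(cross3 (f r) g' + cross3 f' (g r)) \<bullet> w = 0"
    if "(f has_vector_derivative f') (at r)" "(g has_vector_derivative g') (at r)"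
      "open T" "r \<in> T" "\<And>r. r \<in> T \<Longrightarrow> cross3 (f r) (g r) \<bullet> w = 0" for f g :: "real \<Rightarrow> real^3" and f' g' r T
  proof -
    have "((\<lambda>r. cross3 (f r) (g r) \<bullet> w) has_real_derivative (cross3 (f r) g' + cross3 f' (g r)) \<bullet> w) (at r)"
      using has_real_derivative_inner[OF has_vector_derivative_cross3[OF that(1,2)] has_vector_derivative_const[of w]]
      by simp
    moreover have "((\<lambda>r. cross3 (f r) (g r) \<bullet> w) has_real_derivative 0) (at r)"
      by (rule has_field_derivative_transform_within_open[of "\<lambda>_. 0" _ _ T]) (use that in auto)
    ultimately show ?thesis using DERIV_unique by blast
  qed
  have openV: "open {s'. (s', t) \<in> V}" "open {t'. (s, t') \<in> V}"
  proof -
    have "open ((\<lambda>s'. (s', t)) -` V)" "open ((\<lambda>t'. (s, t')) -` V)"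
      by (intro open_vimage V(1) continuous_intros)+
    then show "open {s'. (s', t) \<in> V}" "open {t'. (s, t') \<in> V}" by (simp_all add: vimage_def)
  qed
  \<comment> \<open>Symmetry of the mixed partials lets the same \<open>xy'\<close> occur in
    \<open>z1\<close> and \<open>z2\<close>.\<close>
  have z1: "(cross3 x xy' + cross3 xx y) \<bullet> w = 0"
    using zero[OF pd(1,3) openV(1)] tan p sym by (simp add: st xy d2)
  have z2: "(cross3 x yy + cross3 xy' y) \<bullet> w = 0"
    using zero[OF pd(2,4) openV(2)] tan p by (simp add: st xy d2)
  define a b where ab: "a = (w \<bullet> x) * (y \<bullet> y) - (w \<bullet> y) * (x \<bullet> y)" "b = (w \<bullet> y) * (x \<bullet> x) - (w \<bullet> x) * (x \<bullet> y)"
  have exp: "(N \<bullet> N) *\<^sub>R w = a *\<^sub>R x + b *\<^sub>R y"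
    unfolding N_def ab using cross3_frame_expansion[of x y w] tan[OF p] by (simp add: xy)
  have "a \<noteq> 0 \<or> b \<noteq> 0" using exp N w by auto
  \<comment> \<open>Weingarten relations for the unnormalised normal: pairing a partial of
    \<open>N\<close> with \<open>x\<close> or \<open>y\<close> gives minus a coefficient of the
    second fundamental form.\<close>
  moreover have "a * (xx \<bullet> N) + b * (xy' \<bullet> N) = - ((cross3 x xy' + cross3 xx y) \<bullet> (a *\<^sub>R x + b *\<^sub>R y))"
    "a * (xy' \<bullet> N) + b * (yy \<bullet> N) = - ((cross3 x yy + cross3 xy' y) \<bullet> (a *\<^sub>R x + b *\<^sub>R y))"
    by (simp_all add: N_def cross3_simps)
  then have "a * (xx \<bullet> N) + b * (xy' \<bullet> N) = 0" "a * (xy' \<bullet> N) + b * (yy \<bullet> N) = 0"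
    unfolding exp[symmetric] using z1 z2 by simp_all
  ultimately have "(xx \<bullet> N) * (yy \<bullet> N) = (xy' \<bullet> N)^2" by algebra
  then show ?thesis
    unfolding param_gaussian_curvature_def Let_def unit_normal_def xy[symmetric] d2[symmetric] N_def[symmetric]
    by (simp add: power2_eq_square field_simps)
qed

text \<open>For any parametrization, the parameters sent into a cylindrical neighbourhood form an
  open set, on which the common ruling direction is tangent by
  \<open>line_in_surface_tangent\<close>.\<close>

lemma locally_cylindrical_imp_flat:
  assumes S: "regular_surface S" and cyl: "locally_cylindrical S"
  shows "constant_gaussian_curvature S"
  unfolding constant_gaussian_curvature_def
proof (intro exI ballI)
  fix q assume q: "q \<in> S"
  show "has_gaussian_curvature S q 0"
    unfolding has_gaussian_curvature_def
  proof (intro conjI allI ballI impI)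
    show "\<exists>U X. regular_parametrization S U X \<and> q \<in> X ` U" using S q unfolding regular_surface_def by (rule bspec)
  next
    fix U X p assume p: "p \<in> U" and "regular_parametrization S U X \<and> X p = q"
    then have par: "regular_parametrization S U X" and Xp: "X p = q" by simp_all
    obtain W where W: "openin (top_of_set S) W" "q \<in> W" "cylindrical_surface W"
      using cyl q unfolding locally_cylindrical_def by blast
    obtain w where w: "w \<noteq> 0" "\<And>q. q \<in> W \<Longrightarrow> \<exists>\<eta>>0. \<forall>\<tau>. \<bar>\<tau>\<bar> < \<eta> \<longrightarrow> q + \<tau> *\<^sub>R w \<in> W"
      using cylindrical_surface_rulings[OF W(3)] by blast
    have WS: "W \<subseteq> S" using W(1) by (rule openin_imp_subset)
    show "param_gaussian_curvature X p = 0"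
    proof (rule ruled_imp_zero_curvature[OF par _ regular_parametrization_vimage_open[OF par W(1)] _ w(1)])
      show "p \<in> {p \<in> U. X p \<in> W}" using p Xp W(2) by simp
      fix p' assume p': "p' \<in> {p \<in> U. X p \<in> W}"
      then obtain \<eta> where "\<eta> > 0" "\<And>\<tau>. \<bar>\<tau>\<bar> < \<eta> \<Longrightarrow> X p' + \<tau> *\<^sub>R w \<in> S" using w(2) WS by blast
      then show "cross3 (du X p') (dv X p') \<bullet> w = 0"
        using line_in_surface_tangent[OF par _ ] p' by blast
    qed auto
  qed
qed

subsection \<open>Translation patches of cylindrical surfaces\<close>

text \<open>The radii in \<open>rul\<close> depend on the point, so a uniform range of
  \<open>t\<close> needs connectedness. The set of \<open>t\<close> whose point lies in the image of
  the open ball is open by \<open>rul\<close>; it is closed because the image of the sphere is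
  avoided and that of the closed ball is compact.\<close>

lemma ruling_stays_in_patch:
  fixes w x0 :: "real^3"
  assumes par: "regular_parametrization S U X" and WS: "W \<subseteq> S"
    and rul: "\<And>q. q \<in> W \<Longrightarrow> \<exists>\<eta>>0. \<forall>\<tau>. \<bar>\<tau>\<bar> < \<eta> \<longrightarrow> q + \<tau> *\<^sub>R w \<in> W"
    and ball: "cball p \<rho> \<subseteq> {p \<in> U. X p \<in> W}"
    and start: "x0 \<in> X ` ball p \<rho>"
    and avoid: "\<And>t. \<bar>t\<bar> < \<epsilon> \<Longrightarrow> x0 + t *\<^sub>R w \<notin> X ` sphere p \<rho>"
    and t: "\<bar>t\<bar> < \<epsilon>"
  shows "x0 + t *\<^sub>R w \<in> X ` ball p \<rho>"
proof -
  define J where "J = {-\<epsilon><..<\<epsilon>}"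
  define T where "T = {t \<in> J. x0 + t *\<^sub>R w \<in> X ` ball p \<rho>}"
  have ballU: "cball p \<rho> \<subseteq> U" using ball by blast
  have contl: "continuous_on A (\<lambda>t. x0 + t *\<^sub>R w)" for A by (intro continuous_intros)
  have "T = J \<inter> (\<lambda>t. x0 + t *\<^sub>R w) -` (X ` cball p \<rho>)"
  proof -
    have "X ` cball p \<rho> = X ` ball p \<rho> \<union> X ` sphere p \<rho>"
      unfolding image_Un[symmetric] by (rule arg_cong[of _ _ "image X"]) auto
    then have "x0 + t *\<^sub>R w \<in> X ` ball p \<rho> \<longleftrightarrow> x0 + t *\<^sub>R w \<in> X ` cball p \<rho>" if "t \<in> J" for t
      using avoid[of t] that unfolding J_def by (simp add: abs_less_iff)
    then show ?thesis unfolding T_def by blast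
  qed
  moreover have "compact (X ` cball p \<rho>)"
    by (intro compact_continuous_image continuous_on_subset[OF smooth_map_on_continuous ballU]
        regular_parametrizationD(2)[OF par] compact_cball)
  ultimately have cl: "closedin (top_of_set J) T"
    using continuous_closedin_preimage[OF contl compact_imp_closed] by metis
  have "openin (top_of_set S) (X ` ball p \<rho>)"
    by (rule regular_parametrization_openin[OF par open_ball]) (use ballU ball_subset_cball[of p \<rho>] in blast)
  then obtain O' where O': "open O'" "X ` ball p \<rho> = S \<inter> O'" by (auto simp: openin_open)
  have "\<exists>e>0. ball t e \<subseteq> T" if "t \<in> T" for t
  proof -
    have tJ: "t \<in> J" and tb: "x0 + t *\<^sub>R w \<in> X ` ball p \<rho>" using that by (auto simp: T_def)
    from tb obtain y where y: "y \<in> ball p \<rho>" "x0 + t *\<^sub>R w = X y" by (elim imageE)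
    have "y \<in> {p \<in> U. X p \<in> W}" using y(1) by (intro subsetD[OF ball] subsetD[OF ball_subset_cball])
    then have "x0 + t *\<^sub>R w \<in> W" using y(2) by simp
    from rul[OF this] obtain \<eta> where \<eta>: "\<eta> > 0" "\<And>\<tau>. \<bar>\<tau>\<bar> < \<eta> \<Longrightarrow> x0 + t *\<^sub>R w + \<tau> *\<^sub>R w \<in> W"
      by blast
    have "open ((\<lambda>t. x0 + t *\<^sub>R w) -` O')" by (intro open_vimage O'(1) contl)
    moreover have "open J" by (simp add: J_def)
    ultimately have "open (J \<inter> (\<lambda>t. x0 + t *\<^sub>R w) -` O')" by blast
    moreover have "t \<in> J \<inter> (\<lambda>t. x0 + t *\<^sub>R w) -` O'" using tJ tb O'(2) by auto
    ultimately obtain e where e: "e > 0" "ball t e \<subseteq> J \<inter> (\<lambda>t. x0 + t *\<^sub>R w) -` O'"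
      using open_contains_ball by blast
    have "ball t (min e \<eta>) \<subseteq> T"
    proof
      fix r assume r: "r \<in> ball t (min e \<eta>)"
      then have "\<bar>r - t\<bar> < \<eta>" by (simp add: dist_real_def abs_minus_commute)
      from \<eta>(2)[OF this] have "x0 + r *\<^sub>R w \<in> W" by (simp add: algebra_simps)
      moreover have "r \<in> J \<inter> (\<lambda>t. x0 + t *\<^sub>R w) -` O'" using r e(2) by auto
      ultimately show "r \<in> T" using WS O'(2) by (auto simp: T_def)
    qed
    then show ?thesis using e(1) \<eta>(1) by (intro exI[of _ "min e \<eta>"]) simp
  qed
  then have "open T" by (simp add: open_contains_ball)
  moreover have "T \<subseteq> J" by (auto simp: T_def)
  ultimately have "openin (top_of_set J) T" by (simp add: open_subset)
  moreover have "connected J" by (simp add: J_def)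
  ultimately have "T = {} \<or> T = J" using cl unfolding connected_clopen by blast
  moreover have "0 \<in> T" using start t by (auto simp: T_def J_def)
  moreover have "t \<in> J" using t by (auto simp: J_def)
  ultimately show ?thesis by (auto simp: T_def)
qed

text \<open>Invariance of domain takes the place of the inverse function theorem, as
  \<open>Y\<close> is merely continuous: the composite of \<open>\<Psi>\<close> and \<open>Y\<close>
  is a continuous injection of an open set into the plane, hence a homeomorphism onto an open
  set.\<close>

lemma injective_immersion_regular_parametrization:
  fixes \<Psi> :: "real \<times> real \<Rightarrow> real^3"
  assumes par: "regular_parametrization S U X" and R: "open R" "smooth_map_on \<Psi> R"
    and sub: "\<Psi> ` R \<subseteq> X ` U" and inj: "inj_on \<Psi> R"
    and reg: "\<And>p. p \<in> R \<Longrightarrow> cross3 (du \<Psi> p) (dv \<Psi> p) \<noteq> 0"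
  shows "regular_parametrization S R \<Psi>"
proof -
  obtain Y where Y: "homeomorphism U (X ` U) X Y" using regular_parametrizationD(4)[OF par] by (elim exE)
  define \<phi> where "\<phi> = Y \<circ> \<Psi>"
  have X\<phi>: "X (\<phi> r) = \<Psi> r" if "r \<in> R" for r
    using homeomorphism_apply2[OF Y, of "\<Psi> r"] sub that by (auto simp: \<phi>_def)
  have \<phi>U: "\<phi> ` R \<subseteq> U"
    using homeomorphism_image2[OF Y] sub unfolding \<phi>_def image_comp[symmetric] by blast
  have cont: "continuous_on R \<phi>"
    unfolding \<phi>_def using homeomorphism_cont2[OF Y] sub
    by (intro continuous_on_compose smooth_map_on_continuous[OF R(2)]) (rule continuous_on_subset)
  have inj\<phi>: "inj_on \<phi> R" using X\<phi> inj by (metis inj_on_def)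
  have op: "open (\<phi> ` R)" by (rule invariance_of_domain[OF cont R(1) inj\<phi>])
  have im: "X ` \<phi> ` R = \<Psi> ` R" using X\<phi> by (auto simp: image_image)
  obtain g where g: "homeomorphism R (\<phi> ` R) \<phi> g"
    using invariance_of_domain_homeomorphism[OF R(1) cont _ inj\<phi>] by auto
  have "homeomorphism (\<phi> ` R) (X ` \<phi> ` R) X Y"
    by (rule homeomorphism_of_subsets[OF Y \<phi>U _ refl]) (use \<phi>U in blast)
  from homeomorphism_compose[OF g this]
  have "homeomorphism R (\<Psi> ` R) (X \<circ> \<phi>) (g \<circ> Y)" unfolding im .
  then have "homeomorphism R (\<Psi> ` R) \<Psi> (g \<circ> Y)"
    by (rule homeomorphism_cong) (use X\<phi> in auto)
  moreover have "openin (top_of_set S) (\<Psi> ` R)"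
    using regular_parametrization_openin[OF par op \<phi>U] by (simp add: im)
  ultimately show ?thesis unfolding regular_parametrization_def
    by (intro conjI ballI R reg exI)
qed

text \<open>The patch is a curve on the surface, transversal to \<open>w\<close>, moved along
  \<open>w\<close>. Both parameter ranges are taken so small that the moved points stay in one patch
  \<open>X\<close>.\<close>

lemma ruled_translation_patch:
  assumes par: "regular_parametrization S U X" and p: "p \<in> U" "X p \<in> W"
    and W: "openin (top_of_set S) W" and w: "w \<noteq> 0"
    and rul: "\<And>q. q \<in> W \<Longrightarrow> \<exists>\<eta>>0. \<forall>\<tau>. \<bar>\<tau>\<bar> < \<eta> \<longrightarrow> q + \<tau> *\<^sub>R w \<in> W"
  shows "\<exists>I J \<alpha> \<beta>.
        open I \<and> is_interval I \<and> open J \<and> is_interval J \<and>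
        smooth_map_on \<alpha> I \<and> smooth_map_on \<beta> J \<and>
        (\<forall>s\<in>I. \<forall>t\<in>J. cross3 (vector_derivative \<alpha> (at s)) (vector_derivative \<beta> (at t)) \<noteq> 0) \<and>
        regular_parametrization S (I \<times> J) (\<lambda>(s, t). \<alpha> s + \<beta> t) \<and>
        X p \<in> (\<lambda>(s, t). \<alpha> s + \<beta> t) ` (I \<times> J)"
proof -
  note D = regular_parametrizationD[OF par]
  have WS: "W \<subseteq> S" using W by (rule openin_imp_subset)
  define X' where "X' e p = frechet_derivative X (at p) e" for e p
  \<comment> \<open>A coordinate direction works, since \<open>du X p\<close> and
    \<open>dv X p\<close> cannot both be parallel to \<open>w\<close>.\<close>
  obtain e where e: "e \<noteq> 0" "cross3 (X' e p) w \<noteq> 0"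
  proof (cases "cross3 (du X p) w = 0 \<and> cross3 (dv X p) w = 0")
    case True
    have par: "(w \<bullet> w) *\<^sub>R v = (w \<bullet> v) *\<^sub>R w" if "cross3 v w = 0" for v
    proof -
      have "cross3 w (cross3 v w) = (w \<bullet> w) *\<^sub>R v - (w \<bullet> v) *\<^sub>R w" by (simp add: cross3_simps forall_3)
      then show ?thesis using that by simp
    qed
    have "((w \<bullet> w) * (w \<bullet> w)) *\<^sub>R cross3 (du X p) (dv X p) = cross3 ((w \<bullet> w) *\<^sub>R du X p) ((w \<bullet> w) *\<^sub>R dv X p)"
      by (simp add: cross_mult_left cross_mult_right)
    also have "\<dots> = 0" using True par by (simp add: cross_mult_left cross_mult_right)
    finally have False using w D(5)[OF p(1)] by simp
    then show ?thesis ..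
  next
    case False
    then show ?thesis using that[of "(1, 0)"] that[of "(0, 1)"] by (auto simp: X'_def du_def dv_def prod_eq_iff)
  qed
  \<comment> \<open>\<open>m\<close> is \<open>|w|^2\<close> times the component of
    \<open>X' e p\<close> orthogonal to \<open>w\<close>. Pairing with \<open>m\<close> is constant
    along rulings and increases along \<open>\<alpha>\<close>, which gives injectivity; by
    \<open>mdot\<close> a positive pairing also gives regularity.\<close>
  define m where "m = cross3 w (cross3 (X' e p) w)"
  have mw: "m \<bullet> w = 0" by (simp add: m_def dot_cross_self)
  have mdot: "v \<bullet> m = cross3 v w \<bullet> cross3 (X' e p) w" for v by (simp add: m_def cross3_simps)
  have mpos: "X' e p \<bullet> m > 0" using e(2) by (simp add: mdot)
  define \<alpha> where "\<alpha> s = X (s *\<^sub>R e + p)" for s :: real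
  define \<beta> where "\<beta> t = t *\<^sub>R w" for t :: real
  define U' where "U' = {p \<in> U. X p \<in> W}"
  have U': "open U'" "p \<in> U'" unfolding U'_def using regular_parametrization_vimage_open[OF par W] p by auto
  obtain \<rho> where \<rho>: "\<rho> > 0" "cball p \<rho> \<subseteq> U'" using U' open_contains_cball by blast
  have \<rho>U: "cball p \<rho> \<subseteq> U" using \<rho>(2) by (auto simp: U'_def)
  have "X p \<notin> X ` sphere p \<rho>"
  proof
    assume "X p \<in> X ` sphere p \<rho>"
    then obtain x where x: "x \<in> sphere p \<rho>" "X p = X x" by (elim imageE)
    then have "x \<in> U" using \<rho>U sphere_cball[of p \<rho>] by blast
    then have "p = x" by (rule inj_onD[OF regular_parametrization_inj[OF par] x(2) p(1)])
    then show False using x(1) \<rho>(1) by simp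
  qed
  moreover have "closed (X ` sphere p \<rho>)"
    by (intro compact_imp_closed compact_continuous_image compact_sphere
        continuous_on_subset[OF smooth_map_on_continuous[OF D(2)]] order_trans[OF sphere_cball \<rho>U])
  ultimately have "\<exists>d>0. \<forall>x\<in>X ` sphere p \<rho>. d \<le> dist (X p) x"
    by (intro separate_point_closed)
  then obtain d where d: "d > 0" "\<And>x. x \<in> X ` sphere p \<rho> \<Longrightarrow> d \<le> dist (X p) x"
    by (elim exE conjE) (rule that, assumption, erule bspec)
  \<comment> \<open>The distance \<open>d\<close> from \<open>X p\<close> to the image of the sphere
    is split: half for the curve, through \<open>G\<close>, and half for the ruling, through
    \<open>\<epsilon>\<close>. The patch then never meets that image.\<close>
  define G where "G = {x \<in> ball p \<rho>. 0 < X' e x \<bullet> m \<and> dist (X p) (X x) < d / 2}"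
  have "open G"
  proof -
    have bU: "ball p \<rho> \<subseteq> U" using \<rho>U ball_subset_cball[of p \<rho>] by blast
    have "continuous_on (ball p \<rho>) (X' e)" "continuous_on (ball p \<rho>) X"
      unfolding X'_def[abs_def]
      by (rule continuous_on_subset[OF smooth_map_on_continuous bU], intro smooth_map_on_frechet_derivative D(1,2))+
    then have "continuous_on (ball p \<rho>) (\<lambda>x. X' e x \<bullet> m)" "continuous_on (ball p \<rho>) (\<lambda>x. dist (X p) (X x))"
      by (auto intro!: continuous_intros)
    then have "open (ball p \<rho> \<inter> (\<lambda>x. X' e x \<bullet> m) -` {0<..})" "open (ball p \<rho> \<inter> (\<lambda>x. dist (X p) (X x)) -` {..<d/2})"
      by (auto intro!: continuous_open_preimage)
    then have "open ((ball p \<rho> \<inter> (\<lambda>x. X' e x \<bullet> m) -` {0<..}) \<inter> (ball p \<rho> \<inter> (\<lambda>x. dist (X p) (X x)) -` {..<d/2}))"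
      by (rule open_Int)
    also have "\<dots> = G" by (auto simp: G_def)
    finally show ?thesis .
  qed
  moreover have "p \<in> G" using \<rho>(1) mpos d(1) by (simp add: G_def)
  ultimately obtain r where r: "r > 0" "ball p r \<subseteq> G" using open_contains_ball by blast
  define \<delta> where "\<delta> = r / norm e"
  have \<delta>: "\<delta> > 0" using r(1) e(1) by (simp add: \<delta>_def)
  define \<epsilon> where "\<epsilon> = d / (2 * norm w)"
  have \<epsilon>: "\<epsilon> > 0" using d(1) w by (simp add: \<epsilon>_def)
  define I where "I = {-\<delta><..<\<delta>}"
  define J where "J = {-\<epsilon><..<\<epsilon>}"
  have sG: "s *\<^sub>R e + p \<in> G" if "s \<in> I" for s
  proof -
    have "norm (s *\<^sub>R e) < r" using that e(1) by (auto simp: I_def \<delta>_def field_simps abs_less_iff)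
    then have "s *\<^sub>R e + p \<in> ball p r" by (simp add: dist_norm)
    then show ?thesis using r(2) by blast
  qed
  have sU: "s *\<^sub>R e + p \<in> U" if "s \<in> I" for s
    using sG[OF that] \<rho>U ball_subset_cball[of p \<rho>] by (auto simp: G_def)
  have IJ: "open I" "is_interval I" "open J" "is_interval J" "0 \<in> I" "0 \<in> J"
    using \<delta> \<epsilon> by (auto simp: I_def J_def is_interval_convex_1)
  have sm\<alpha>: "smooth_map_on \<alpha> I"
    unfolding \<alpha>_def[abs_def]
    by (rule smooth_map_on_compose_affine[OF bounded_linear_scaleR_left D(1) IJ(1) sU D(2)])
  have sm\<beta>: "smooth_map_on \<beta> J"
    unfolding \<beta>_def[abs_def] by (rule smooth_map_on_linear[OF bounded_linear_scaleR_left IJ(3)])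
  have d\<alpha>: "((\<lambda>s. X (s *\<^sub>R e + p)) has_derivative (\<lambda>h. frechet_derivative X (at (s *\<^sub>R e + p)) (h *\<^sub>R e))) (at s)"
    if "s \<in> I" for s
  proof -
    have "((\<lambda>s. s *\<^sub>R e + p) has_derivative (\<lambda>h. h *\<^sub>R e)) (at s)"
      by (auto intro!: derivative_eq_intros)
    from has_derivative_compose[OF this smooth_map_on_has_derivative[OF D(1,2) sU[OF that]]]
    show ?thesis .
  qed
  have c\<alpha>: "curve_deriv \<alpha> s = X' e (s *\<^sub>R e + p)" if "s \<in> I" for s
    unfolding curve_deriv_def \<alpha>_def[abs_def] X'_def
    using fun_cong[OF frechet_derivative_at[OF d\<alpha>[OF that]], of 1] by simp
  have c\<beta>: "curve_deriv \<beta> t = w" for t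
    unfolding curve_deriv_def \<beta>_def[abs_def]
    by (subst frechet_derivative_at[symmetric, of _ "\<lambda>h. h *\<^sub>R w"]) (auto intro!: derivative_eq_intros)
  have pos: "curve_deriv \<alpha> s \<bullet> m > 0" if "s \<in> I" for s using sG[OF that] c\<alpha>[OF that] by (simp add: G_def)
  have reg: "cross3 (curve_deriv \<alpha> s) (curve_deriv \<beta> t) \<noteq> 0" if "s \<in> I" for s t
    using pos[OF that] by (auto simp: mdot c\<beta>)
  define \<Psi> where "\<Psi> = (\<lambda>(s, t). \<alpha> s + \<beta> t)"
  have sm\<Psi>: "smooth_map_on \<Psi> (I \<times> J)"
  proof -
    \<comment> \<open>The summands \<open>0\<close> bring the projections into the affine form of
      \<open>smooth_map_on_compose_affine\<close>.\<close>
    have "smooth_map_on (\<lambda>z. \<alpha> (fst z + 0) + \<beta> (snd z + 0)) (I \<times> J)"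
      by (intro smooth_map_on_add smooth_map_on_compose_affine[OF bounded_linear_fst IJ(1) _ _ sm\<alpha>]
          smooth_map_on_compose_affine[OF bounded_linear_snd IJ(3) _ _ sm\<beta>]) (use IJ in \<open>auto simp: open_Times\<close>)
    then show ?thesis by (simp add: \<Psi>_def case_prod_beta')
  qed
  have "\<Psi> z \<in> X ` U" if "z \<in> I \<times> J" for z
  proof -
    obtain s t where z: "z = (s, t)" "s \<in> I" "t \<in> J" using \<open>z \<in> I \<times> J\<close> by auto
    have "\<alpha> s + t *\<^sub>R w \<in> X ` ball p \<rho>"
    proof (rule ruling_stays_in_patch[OF par WS rul \<rho>(2)[unfolded U'_def]])
      show "\<alpha> s \<in> X ` ball p \<rho>" using sG[OF z(2)] by (auto simp: \<alpha>_def G_def)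
      show "\<bar>t\<bar> < \<epsilon>" using z(3) by (auto simp: J_def)
      fix t' assume t': "\<bar>t'\<bar> < \<epsilon>"
      have "dist (X p) (\<alpha> s + t' *\<^sub>R w) \<le> dist (X p) (\<alpha> s) + norm (t' *\<^sub>R w)"
        using dist_triangle[of "X p" "\<alpha> s + t' *\<^sub>R w" "\<alpha> s"] by (simp add: dist_norm)
      also have "\<dots> < d / 2 + d / 2"
      proof (rule add_strict_mono)
        show "dist (X p) (\<alpha> s) < d / 2" using sG[OF z(2)] by (simp add: \<alpha>_def G_def)
        show "norm (t' *\<^sub>R w) < d / 2" using t' w by (simp add: \<epsilon>_def field_simps)
      qed
      finally have "dist (X p) (\<alpha> s + t' *\<^sub>R w) < d" by simp
      then show "\<alpha> s + t' *\<^sub>R w \<notin> X ` sphere p \<rho>" using d(2)[of "\<alpha> s + t' *\<^sub>R w"] by linarith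
    qed
    moreover have "X ` ball p \<rho> \<subseteq> X ` U" by (intro image_mono order_trans[OF ball_subset_cball \<rho>U])
    moreover have "\<Psi> z = \<alpha> s + t *\<^sub>R w" by (simp add: z \<Psi>_def \<beta>_def)
    ultimately show ?thesis by auto
  qed
  then have sub: "\<Psi> ` (I \<times> J) \<subseteq> X ` U" by blast
  have mono: "\<alpha> s \<bullet> m < \<alpha> s' \<bullet> m" if "s \<in> I" "s' \<in> I" "s < s'" for s s'
  proof (rule DERIV_pos_imp_increasing[OF that(3)])
    fix x assume "s \<le> x" "x \<le> s'"
    then have x: "x \<in> I" using that by (auto simp: I_def)
    have "((\<lambda>s. \<alpha> s \<bullet> m) has_real_derivative curve_deriv \<alpha> x \<bullet> m) (at x)"
      using has_real_derivative_inner[OF curve_deriv_vector_derivative(1)[OF IJ(1) sm\<alpha> x] has_vector_derivative_const[of m]]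
      by simp
    then show "\<exists>y. ((\<lambda>s. \<alpha> s \<bullet> m) has_real_derivative y) (at x) \<and> 0 < y" using pos[OF x] by blast
  qed
  have inj: "inj_on \<Psi> (I \<times> J)"
  proof (rule inj_onI)
    fix z z' assume "z \<in> I \<times> J" "z' \<in> I \<times> J" "\<Psi> z = \<Psi> z'"
    then obtain s t s' t' where z: "z = (s, t)" "z' = (s', t')" "s \<in> I" "s' \<in> I"
      and eq: "\<alpha> s + t *\<^sub>R w = \<alpha> s' + t' *\<^sub>R w" by (auto simp: \<Psi>_def \<beta>_def)
    have "(\<alpha> s + t *\<^sub>R w) \<bullet> m = (\<alpha> s' + t' *\<^sub>R w) \<bullet> m" using eq by simp
    then have "\<alpha> s \<bullet> m = \<alpha> s' \<bullet> m" using mw unfolding inner_add_left inner_scaleR_left inner_commute[of w] by simp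
    then have "s = s'" using mono[OF z(3,4)] mono[OF z(4,3)] by linarith
    then show "z = z'" using eq w z by simp
  qed
  have "regular_parametrization S (I \<times> J) \<Psi>"
  proof (rule injective_immersion_regular_parametrization[OF par _ sm\<Psi> sub inj])
    show "open (I \<times> J)" using IJ by (simp add: open_Times)
    fix z assume "z \<in> I \<times> J"
    then obtain s t where z: "z = (s, t)" "s \<in> I" "t \<in> J" by auto
    show "cross3 (du \<Psi> z) (dv \<Psi> z) \<noteq> 0"
      using translation_patch_derivatives(1,2)[OF IJ(1) sm\<alpha> IJ(3) sm\<beta> z(2,3)] reg[OF z(2)]
      unfolding \<Psi>_def z(1) by simp
  qed
  moreover have "X p \<in> \<Psi> ` (I \<times> J)"
    using IJ(5,6) by (intro image_eqI[of _ _ "(0, 0)"]) (auto simp: \<Psi>_def \<alpha>_def \<beta>_def)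
  moreover have "cross3 (vector_derivative \<alpha> (at s)) (vector_derivative \<beta> (at t)) \<noteq> 0" if "s \<in> I" "t \<in> J" for s t
    using reg[OF that(1)] curve_deriv_vector_derivative(2)[OF IJ(1) sm\<alpha> that(1)]
      curve_deriv_vector_derivative(2)[OF IJ(3) sm\<beta> that(2)] by simp
  ultimately show ?thesis unfolding \<Psi>_def using IJ(1-4) sm\<alpha> sm\<beta>
    by (intro exI[of _ I] exI[of _ J] exI[of _ \<alpha>] exI[of _ \<beta>] conjI ballI)
qed

lemma locally_cylindrical_imp_translation_surface:
  assumes S: "regular_surface S" and cyl: "locally_cylindrical S"
  shows "translation_surface S"
  unfolding translation_surface_def
proof (intro conjI ballI S)
  fix q assume q: "q \<in> S"
  obtain W where W: "openin (top_of_set S) W" "q \<in> W" "cylindrical_surface W"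
    using cyl q unfolding locally_cylindrical_def by blast
  obtain w where w: "w \<noteq> 0" "\<And>q. q \<in> W \<Longrightarrow> \<exists>\<eta>>0. \<forall>\<tau>. \<bar>\<tau>\<bar> < \<eta> \<longrightarrow> q + \<tau> *\<^sub>R w \<in> W"
    using cylindrical_surface_rulings[OF W(3)] by blast
  obtain U X where par: "regular_parametrization S U X" and "q \<in> X ` U"
    using S q unfolding regular_surface_def by blast
  then obtain p where p: "p \<in> U" "q = X p" by blast
  show "\<exists>I J \<alpha> \<beta>.
        open I \<and> is_interval I \<and> open J \<and> is_interval J \<and>
        smooth_map_on \<alpha> I \<and> smooth_map_on \<beta> J \<and>
        (\<forall>s\<in>I. \<forall>t\<in>J. cross3 (vector_derivative \<alpha> (at s)) (vector_derivative \<beta> (at t)) \<noteq> 0) \<and>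
        regular_parametrization S (I \<times> J) (\<lambda>(s, t). \<alpha> s + \<beta> t) \<and>
        q \<in> (\<lambda>(s, t). \<alpha> s + \<beta> t) ` (I \<times> J)"
    unfolding p(2) by (rule ruled_translation_patch[OF par p(1) _ W(1) w]) (use W(2) p(2) in simp)
qed

theorem theorem1p2:
  fixes S :: "(real^3) set"
  assumes "regular_surface S"
  shows "translation_surface S \<and> constant_gaussian_curvature S \<longleftrightarrow> locally_cylindrical S"
  using translation_surface_constant_curvature_imp_cylindrical
    locally_cylindrical_imp_flat[OF assms] locally_cylindrical_imp_translation_surface[OF assms]
  by blast

end
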